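(* Let $\mathcal C$ be a class of graphs. Then $\mathcal C$ has bounded expansion if and only if there exist functions $F_{\rm ord},F_{\rm deg},F_{\nabla},F_{\rm prop}:\mathbb R\to\mathbb R$, with $F_{\rm prop}$ taking only positive values, such that the following two conditions hold: (1) for every $\epsilon>0$ and every $G\in\mathcal C$, if $|G|>F_{\rm ord}(\epsilon)$ then $$\frac{|\{v\in V(G): d(v)\geq F_{\rm deg}(\epsilon)\}|}{|G|}\leq\epsilon;$$ (2) for every $r\in\mathbb N$, every $G\in\mathcal C$ and every subgraph $H\subseteq G$, if $\widetilde{\nabla}_r(H)>F_{\nabla}(r)$ then $|H|>F_{\rm prop}(r)\,|G|$.
   Context: All graphs are finite, simple and unlabelled; densities are taken over graphs with at least one vertex. $|G|$ is the number of vertices, $\|G\|$ the number of edges, and $d(v)$ the degree of $v$ in $G$. Bounded expansion: for $d\in\mathbb N$, a graph $H$ is a shallow minor of $G$ at depth $d$ if there is a subgraph $X$ of $G$ whose connected components each have radius at most $d$, such that $H$ is a simple graph obtained from $G$ by contracting each component of $X$ into a single vertex and then taking a subgraph. (The radius of a connected graph is the minimum over vertices $r$ of the maximum distance from $r$ to another vertex.) For a class $\mathcal C$, let $\nabla_d(\mathcal C)=\sup \|H\|/|H|$, the supremum over all shallow minors $H$ at depth $d$ of graphs in $\mathcal C$. The class $\mathcal C$ has bounded expansion if there is a function $f:\mathbb N\to\mathbb R$ with $\nabla_d(\mathcal C)\leq f(d)$ for all $d\in\mathbb N$. Topological grad: a $(\leq t)$-subdivision of a graph $H$ is a graph obtained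 from $H$ by replacing each edge $vw$ by a path between $v$ and $w$ with at most $t$ internal (new) vertices. A graph $H$ is a shallow topological minor of $G$ at depth $r$ if some $(\leq 2r)$-subdivision of $H$ is isomorphic to a subgraph of $G$ (i.e. $H$ is obtained from a subgraph of $G$ by replacing paths of length at most $2r+1$ by single edges). $\widetilde{\nabla}_r(G)$ is the supremum of $\|H\|/|H|$ over all shallow topological minors $H$ of $G$ at depth $r$. *)

theory Defs
  imports "Graph_Theory.Graph_Theory" "HOL-Library.Extended_Real"
begin

text \<open>
  A finite simple graph is a \<^term>\<open>pair_graph\<close>: finite, loopfree and symmetric, an undirected
  edge \<open>uv\<close> being the two arcs \<open>(u, v)\<close> and \<open>(v, u)\<close>.  Unlabelled graphs are represented on vertex
  type \<^typ>\<open>nat\<close>, which carries a copy of every finite graph.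
\<close>

definition num_verts :: "'a pair_pre_digraph \<Rightarrow> nat" where
  "num_verts G = card (pverts G)"

definition num_edges :: "'a pair_pre_digraph \<Rightarrow> nat" where
  "num_edges G = card {{u, v} | u v. (u, v) \<in> parcs G}"

definition density :: "'a pair_pre_digraph \<Rightarrow> real" where
  "density G = real (num_edges G) / real (num_verts G)"

text \<open>In a symmetric digraph the out-degree of a vertex is its number of neighbours.\<close>

definition degree :: "'a pair_pre_digraph \<Rightarrow> 'a \<Rightarrow> nat" where
  "degree G v = out_degree (with_proj G) v"

definition is_subgraph :: "'a pair_pre_digraph \<Rightarrow> 'a pair_pre_digraph \<Rightarrow> bool" where
  "is_subgraph H G \<longleftrightarrow> pair_graph H \<and> subgraph (with_proj H) (with_proj G)"

definition isomorphic :: "'a pair_pre_digraph \<Rightarrow> 'b pair_pre_digraph \<Rightarrow> bool" where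
  "isomorphic G H \<longleftrightarrow> digraph_iso (with_proj G) (with_proj H)"

text \<open>The graph distance is the weighted distance \<^const>\<open>wf_digraph.\<mu>\<close> for unit weights.\<close>

definition radius :: "('a, 'b) pre_digraph \<Rightarrow> ereal" where
  "radius G = (INF r \<in> verts G. SUP v \<in> verts G. wf_digraph.\<mu> G (\<lambda>_. 1) r v)"

text \<open>The strongly connected components of a symmetric digraph are its connected components.\<close>

definition components :: "'a pair_pre_digraph \<Rightarrow> ('a, 'a \<times> 'a) pre_digraph set" where
  "components X = pre_digraph.sccs (with_proj X)"

text \<open>
  The vertices of the contracted graph are vertex sets of \<open>G\<close>: those of the components of \<open>X\<close>, and
  a singleton for each vertex outside \<open>X\<close>.  Loops and parallel edges are discarded.
\<close>

definition contract_components :: "'a pair_pre_digraph \<Rightarrow> 'a pair_pre_digraph \<Rightarrow> 'a set pair_pre_digraph" where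
  "contract_components G X =
    (let V = verts ` components X \<union> {{v} | v. v \<in> pverts G - pverts X}
     in \<lparr> pverts = V,
          parcs = {(A, B). A \<in> V \<and> B \<in> V \<and> A \<noteq> B \<and> (\<exists>a\<in>A. \<exists>b\<in>B. (a, b) \<in> parcs G)} \<rparr>)"

definition shallow_minor :: "nat \<Rightarrow> 'b pair_pre_digraph \<Rightarrow> 'a pair_pre_digraph \<Rightarrow> bool" where
  "shallow_minor d H G \<longleftrightarrow> pair_graph H \<and>
    (\<exists>X. is_subgraph X G \<and> (\<forall>K \<in> components X. radius K \<le> ereal (real d)) \<and>
      (\<exists>K. is_subgraph K (contract_components G X) \<and> isomorphic K H))"

text \<open>
  The suprema are taken in \<^typ>\<open>ereal\<close>, so they are \<open>\<infinity>\<close> for unbounded sets of densities; a supremum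
  over no graph at all is \<open>-\<infinity>\<close>.
\<close>

definition nabla :: "nat \<Rightarrow> nat pair_pre_digraph set \<Rightarrow> ereal" where
  "nabla d \<C> =
    Sup {ereal (density H) | H :: nat pair_pre_digraph.
          pverts H \<noteq> {} \<and> (\<exists>G\<in>\<C>. shallow_minor d H G)}"

definition bounded_expansion :: "nat pair_pre_digraph set \<Rightarrow> bool" where
  "bounded_expansion \<C> \<longleftrightarrow> (\<exists>f :: nat \<Rightarrow> real. \<forall>d. nabla d \<C> \<le> ereal (f d))"

text \<open>
  \<open>P (u, v)\<close> lists, in order from \<open>u\<close> to \<open>v\<close>, the new vertices on the path replacing the edge \<open>uv\<close>.
\<close>

definition subdividing_paths :: "nat \<Rightarrow> 'a pair_pre_digraph \<Rightarrow> ('a \<times> 'a \<Rightarrow> 'a list) \<Rightarrow> bool" where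
  "subdividing_paths t H P \<longleftrightarrow>
    (\<forall>(u, v) \<in> parcs H.
      P (v, u) = rev (P (u, v)) \<and> length (P (u, v)) \<le> t \<and>
      distinct (P (u, v)) \<and> set (P (u, v)) \<inter> pverts H = {} \<and>
      (\<forall>(x, y) \<in> parcs H. {x, y} \<noteq> {u, v} \<longrightarrow> set (P (x, y)) \<inter> set (P (u, v)) = {}))"

definition subdivide_along :: "'a pair_pre_digraph \<Rightarrow> ('a \<times> 'a \<Rightarrow> 'a list) \<Rightarrow> 'a pair_pre_digraph" where
  "subdivide_along H P =
    \<lparr> pverts = pverts H \<union> (\<Union>e \<in> parcs H. set (P e)),
      parcs = (\<Union>(u, v) \<in> parcs H. set (vwalk_arcs (u # P (u, v) @ [v]))) \<rparr>"

definition le_subdivision :: "nat \<Rightarrow> 'a pair_pre_digraph \<Rightarrow> 'a pair_pre_digraph \<Rightarrow> bool" where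
  "le_subdivision t H S \<longleftrightarrow> (\<exists>P. subdividing_paths t H P \<and> S = subdivide_along H P)"

definition shallow_topological_minor :: "nat \<Rightarrow> 'b pair_pre_digraph \<Rightarrow> 'a pair_pre_digraph \<Rightarrow> bool" where
  "shallow_topological_minor r H G \<longleftrightarrow> pair_graph H \<and>
    (\<exists>S K. le_subdivision (2 * r) H S \<and> is_subgraph K G \<and> isomorphic S K)"

definition top_nabla :: "nat \<Rightarrow> nat pair_pre_digraph \<Rightarrow> ereal" where
  "top_nabla r G =
    Sup {ereal (density H) | H :: nat pair_pre_digraph.
          pverts H \<noteq> {} \<and> shallow_topological_minor r H G}"

end

theory Submission
  imports Defs
begin

text \<open>
  The theorem says that the two conditions control the density of all shallow minors.  The work is
  in passing between \<^emph>\<open>topological\<close> minors, which the conditions speak of, and arbitrary shallow minors,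
  which define bounded expansion.  Everything is phrased for the edge relation \<open>E\<close> of a graph:
  \<open>sparse E t K\<close> says that every graph \<open>(Z, M)\<close> that sits in \<open>E\<close> with its edges subdivided at most \<open>t\<close>
  times satisfies \<open>card M \<le> K * card Z\<close>.

  \<^bold>\<open>From the conditions to topological minors.\<close>  Let \<open>(Z, M)\<close> be a topological minor of a large \<open>G\<close> and
  let \<open>B\<close> be the set of vertices of high degree in \<open>G\<close>, which is a tiny fraction of \<open>G\<close> by the first
  condition.  Edges of \<open>M\<close> with an end outside \<open>B\<close> number at most (degree bound) \<open>* card Z\<close>.  If the edges
  inside \<open>B\<close> were dense, a selection of only \<open>c * card (Z \<inter> B)\<close> of them would already be dense, and the
  subdivided selection would be a dense topological minor in a subgraph with \<open>O (card B)\<close> vertices,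
  contradicting the second condition (\<open>sparse_if_dense_parts_large\<close>).  Small graphs \<open>G\<close> are trivially
  sparse.

  \<^bold>\<open>From topological minors to minors.\<close>  Contracting trees of height \<open>d\<close> amounts to contracting stars
  \<open>d\<close> times, lowest level first (\<open>sparse_contract_trees\<close>), so it suffices that contracting stars
  preserves sparseness for all subdivision lengths (\<open>sparse_contract_stars\<close>).  A topological minor of
  the contracted relation lifts to paths between stars.  Each path ends in two \<^emph>\<open>ports\<close>, vertices of
  its two stars.  The graph of these paths on the ports is sparse, hence has an orientation of bounded
  out-degree.  So, up to constant factors, every path leaves through a port that belongs to it alone,
  whose link to the centre can be absorbed into the path; only ports at the receiving end are shared
  (\<open>card_edges_between_stars_le\<close>).  Shared ports are treated greedily in \<open>card_spokes_le\<close>: as long as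
  possible, a port is used up as the midpoint of a new chord between two centres.  The number of chords
  is bounded by sparseness, and a port that is left over sees a clique of chords, hence only boundedly
  many centres.

  \<^bold>\<open>From minors to the conditions.\<close>  Giving each subdividing path to one of its ends shows that a
  topological minor at depth \<open>r\<close> is a minor at depth \<open>2 * r\<close>
  (\<open>shallow_minor_if_shallow_topological_minor\<close>).  So in a class of bounded expansion the hypothesis of
  the second condition can be made void, and the first condition is Markov's inequality for the degrees
  (\<open>high_degree_fraction_le\<close>).
\<close>

section \<open>Topological minors of a relation\<close>

text \<open>
  Only the set \<open>I\<close> of vertices available for the interior of a walk matters, not the walk itself: an
  interior of at most \<open>t\<close> vertices contains a path of at most that length (\<open>linked_path\<close>), and walks,
  unlike paths, can be concatenated without repairs.
\<close>

inductive linked :: "('a \<times> 'a) set \<Rightarrow> 'a set \<Rightarrow> 'a \<Rightarrow> 'a \<Rightarrow> bool" for E I where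
  edge: "(u, v) \<in> E \<Longrightarrow> linked E I u v"
| step: "(u, w) \<in> E \<Longrightarrow> w \<in> I \<Longrightarrow> linked E I w v \<Longrightarrow> linked E I u v"

lemma linked_mono: "linked E I u v \<Longrightarrow> E \<subseteq> F \<Longrightarrow> I \<subseteq> J \<Longrightarrow> linked F J u v"
  by (induction rule: linked.induct) (auto intro: linked.intros)

lemma linked_trans: "linked E I u w \<Longrightarrow> w \<in> I \<Longrightarrow> linked E I w v \<Longrightarrow> linked E I u v"
  by (induction rule: linked.induct) (auto intro: linked.intros)

lemma linked_sym:
  assumes "linked E I u v" "sym E"
  shows "linked E I v u"
  using assms
proof (induction rule: linked.induct)
  case (step u w v)
  have "linked E I w u" using step by (auto intro: linked.edge dest: symD)
  then show ?case using step by (auto intro: linked_trans)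
qed (auto intro: linked.edge dest: symD)

lemma linked_endpoints: "linked E I u v \<Longrightarrow> u \<in> fst ` E \<and> v \<in> snd ` E"
  by (induction rule: linked.induct) force+

lemma linked_first_step: "linked E I u v \<Longrightarrow> \<exists>w \<in> insert v I. (u, w) \<in> E"
  by (induction rule: linked.induct) auto

text \<open>
  The edges \<open>M\<close> carry an arbitrary orientation, so that they can be indexed by pairs and counted by
  \<open>card M\<close>.
\<close>

definition topological_model ::
    "('a \<times> 'a) set \<Rightarrow> nat \<Rightarrow> 'a set \<Rightarrow> ('a \<times> 'a) set \<Rightarrow> ('a \<times> 'a \<Rightarrow> 'a set) \<Rightarrow> bool" where
  "topological_model E t Z M I \<longleftrightarrow> finite Z \<and> M \<subseteq> Z \<times> Z \<and> asym M \<and>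
    (\<forall>e \<in> M. finite (I e) \<and> card (I e) \<le> t \<and> I e \<inter> Z = {} \<and> linked E (I e) (fst e) (snd e)) \<and>
    (\<forall>e \<in> M. \<forall>f \<in> M. e \<noteq> f \<longrightarrow> I e \<inter> I f = {})"

lemma topological_modelD:
  assumes "topological_model E t Z M I"
  shows "finite Z" "finite M" "M \<subseteq> Z \<times> Z" "asym M"
  using assms unfolding topological_model_def by (simp_all add: finite_subset[of M "Z \<times> Z"])

lemma topological_model_pathD:
  assumes "topological_model E t Z M I" "e \<in> M"
  shows "finite (I e)" "card (I e) \<le> t" "I e \<inter> Z = {}" "linked E (I e) (fst e) (snd e)"
  using assms unfolding topological_model_def by simp_all

lemma topological_model_disjointD:
  assumes "topological_model E t Z M I" "e \<in> M" "f \<in> M" "e \<noteq> f"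
  shows "I e \<inter> I f = {}"
  using assms unfolding topological_model_def by simp

text \<open>
  Shrinking \<open>Z\<close> only weakens the demand that interiors avoid \<open>Z\<close>.
\<close>

lemma topological_model_restrict:
  assumes "topological_model E t Z M I" "M' \<subseteq> M" "Z' \<subseteq> Z" "M' \<subseteq> Z' \<times> Z'"
  shows "topological_model E t Z' M' I"
  unfolding topological_model_def
proof (intro conjI ballI impI)
  note model = assms(1)[unfolded topological_model_def]
  show "finite Z'" using model assms(3) finite_subset by blast
  show "M' \<subseteq> Z' \<times> Z'" by fact
  have "asym M" using model by simp
  then show "asym M'" using assms(2) unfolding asym_iff by blast
  fix e assume "e \<in> M'"
  then have e: "e \<in> M" using assms(2) by blast
  then have *: "finite (I e) \<and> card (I e) \<le> t \<and> I e \<inter> Z = {} \<and> linked E (I e) (fst e) (snd e)"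
    using model by simp
  then show "finite (I e)" "card (I e) \<le> t" "linked E (I e) (fst e) (snd e)" by simp_all
  show "I e \<inter> Z' = {}" using * assms(3) by blast
  fix f assume "f \<in> M'" "e \<noteq> f"
  then show "I e \<inter> I f = {}" using model e assms(2) by (meson subsetD)
qed

definition sparse :: "('a \<times> 'a) set \<Rightarrow> nat \<Rightarrow> nat \<Rightarrow> bool" where
  "sparse E t K \<longleftrightarrow> (\<forall>Z M I. topological_model E t Z M I \<longrightarrow> card M \<le> K * card Z)"

lemma sparse_subrel:
  assumes "sparse F t K" "E \<subseteq> F"
  shows "sparse E t K"
  unfolding sparse_def
proof (intro allI impI)
  fix Z M I assume "topological_model E t Z M I"
  moreover have "linked F (I e) u v" if "linked E (I e) u v" for e u v
    using that assms(2) by (rule linked_mono) simp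
  ultimately have "topological_model F t Z M I"
    unfolding topological_model_def by auto
  then show "card M \<le> K * card Z" using assms(1) unfolding sparse_def by blast
qed

lemma sparse_le:
  assumes "sparse E t K" "s \<le> t" "K \<le> L"
  shows "sparse E s L"
  unfolding sparse_def
proof (intro allI impI)
  fix Z M I assume "topological_model E s Z M I"
  then have "topological_model E t Z M I"
    using assms(2) unfolding topological_model_def by fastforce
  then have "card M \<le> K * card Z" using assms(1) unfolding sparse_def by blast
  also have "\<dots> \<le> L * card Z" using assms(3) by simp
  finally show "card M \<le> L * card Z" .
qed

text \<open>
  Vertices of \<open>Z\<close> without an edge only make a model less dense, so it may be assumed that \<open>Z\<close> lies in
  the field of the relation.
\<close>

lemma sparseI:
  assumes "\<And>Z M I. topological_model E t Z M I \<Longrightarrow> Z \<subseteq> fst ` E \<union> snd ` E \<Longrightarrow> card M \<le> K * card Z"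
  shows "sparse E t K"
  unfolding sparse_def
proof (intro allI impI)
  fix Z M I assume model: "topological_model E t Z M I"
  define Z0 where "Z0 = fst ` M \<union> snd ` M"
  have Z: "finite Z" "M \<subseteq> Z \<times> Z" using model by (simp_all add: topological_model_def)
  then have Z0: "Z0 \<subseteq> Z" "M \<subseteq> Z0 \<times> Z0" by (force simp: Z0_def)+
  have "linked E (I e) (fst e) (snd e)" if "e \<in> M" for e
    using model that by (simp add: topological_model_def)
  then have "Z0 \<subseteq> fst ` E \<union> snd ` E" using linked_endpoints by (fastforce simp: Z0_def)
  then have "card M \<le> K * card Z0"
    using assms topological_model_restrict[OF model _ Z0] by blast
  also have "\<dots> \<le> K * card Z" using card_mono[OF Z(1) Z0(1)] by simp
  finally show "card M \<le> K * card Z" .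
qed

lemma sparse_few_vertices:
  assumes "finite V" "card V \<le> K" "E \<subseteq> V \<times> V"
  shows "sparse E t K"
proof (rule sparseI)
  fix Z M and I :: "'a \<times> 'a \<Rightarrow> 'a set"
  assume model: "topological_model E t Z M I" and "Z \<subseteq> fst ` E \<union> snd ` E"
  moreover have "fst ` E \<union> snd ` E \<subseteq> V" using assms(3) by auto
  ultimately have "Z \<subseteq> V" by blast
  then have "card Z \<le> K" using assms(1,2) card_mono le_trans by blast
  have "finite Z" "M \<subseteq> Z \<times> Z" using model by (simp_all add: topological_model_def)
  then have "card M \<le> card Z * card Z"
    using card_mono[of "Z \<times> Z" M] by (simp add: card_cartesian_product)
  also have "\<dots> \<le> K * card Z" using \<open>card Z \<le> K\<close> by simp
  finally show "card M \<le> K * card Z" .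
qed

text \<open>
  The form in which sparseness is applied: the edges are indexed by an arbitrary set, so that edges
  of one graph can serve, with other ends and other interiors, as the edges of another.
\<close>

lemma sparse_family:
  fixes N :: "'e set" and a b :: "'e \<Rightarrow> 'a"
  assumes sparse: "sparse E t K" and fin: "finite Z" "finite N"
    and ends: "\<And>e. e \<in> N \<Longrightarrow> a e \<in> Z \<and> b e \<in> Z \<and> a e \<noteq> b e"
    and inj: "\<And>e f. e \<in> N \<Longrightarrow> f \<in> N \<Longrightarrow> {a e, b e} = {a f, b f} \<Longrightarrow> e = f"
    and path: "\<And>e. e \<in> N \<Longrightarrow> finite (J e) \<and> card (J e) \<le> t \<and> J e \<inter> Z = {} \<and> linked E (J e) (a e) (b e)"
    and disj: "\<And>e f. e \<in> N \<Longrightarrow> f \<in> N \<Longrightarrow> e \<noteq> f \<Longrightarrow> J e \<inter> J f = {}"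
  shows "card N \<le> K * card Z"
proof -
  define ab where "ab e = (a e, b e)" for e
  have inj_ab: "inj_on ab N"
    by (rule inj_onI) (auto simp: ab_def intro: inj)
  define I where "I = J \<circ> inv_into N ab"
  have I: "I (ab e) = J e" if "e \<in> N" for e
    using that inj_ab by (simp add: I_def)
  have "asym (ab ` N)"
  proof (rule asymI)
    fix u v assume "(u, v) \<in> ab ` N"
    then obtain e where e: "e \<in> N" "u = a e" "v = b e" by (auto simp: ab_def)
    show "(v, u) \<notin> ab ` N"
    proof
      assume "(v, u) \<in> ab ` N"
      then obtain f where f: "f \<in> N" "v = a f" "u = b f" by (auto simp: ab_def)
      then have "e = f" using e by (intro inj) auto
      then show False using e(3) f(2) ends[OF e(1)] by auto
    qed
  qed
  moreover have "ab ` N \<subseteq> Z \<times> Z" using ends by (auto simp: ab_def)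
  moreover have "finite (I (ab e)) \<and> card (I (ab e)) \<le> t \<and> I (ab e) \<inter> Z = {} \<and>
      linked E (I (ab e)) (fst (ab e)) (snd (ab e))" if "e \<in> N" for e
    using path[OF that] I[OF that] by (simp add: ab_def)
  moreover have "I (ab e) \<inter> I (ab f) = {}" if "e \<in> N" "f \<in> N" "ab e \<noteq> ab f" for e f
    using disj[OF that(1,2)] that I by auto
  ultimately have "topological_model E t Z (ab ` N) I"
    using fin unfolding topological_model_def by blast
  then have "card (ab ` N) \<le> K * card Z" using sparse unfolding sparse_def by blast
  then show ?thesis using inj_ab by (simp add: card_image)
qed

section \<open>Fibres, orientations and cuts\<close>

text \<open>
  Passing to images, or to one representative per fibre, costs only a constant factor when the
  fibres are bounded.
\<close>

lemma card_le_fibres: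
  assumes "finite M" "\<And>q. q \<in> h ` M \<Longrightarrow> card {e \<in> M. h e = q} \<le> k"
  shows "card M \<le> k * card (h ` M)"
proof -
  have "card M = (\<Sum>q \<in> h ` M. card {e \<in> M. h e = q})"
    using sum.image_gen[OF assms(1), of "\<lambda>_. 1 :: nat" h] by simp
  also have "\<dots> \<le> (\<Sum>q \<in> h ` M. k)" by (rule sum_mono) (use assms in auto)
  finally show ?thesis by (simp add: mult.commute)
qed

lemma select_from_fibres:
  assumes "finite M" "\<And>q. q \<in> h ` M \<Longrightarrow> card {e \<in> M. h e = q} \<le> k"
  obtains M' where "M' \<subseteq> M" "inj_on h M'" "card M \<le> k * card M'"
proof -
  obtain M' where M': "M' \<subseteq> M" "inj_on h M'" "h ` M = h ` M'"
    using subset_image_inj[of "h ` M" h M] by auto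
  have "card M \<le> k * card M'"
    using card_le_fibres[OF assms] M' by (simp add: card_image)
  then show ?thesis using that M'(1,2) by blast
qed

text \<open>
  If every subset of the edges is sparse, then some vertex has at most \<open>2 * K\<close> edges; it takes all of
  them as outgoing ones and is removed.
\<close>

lemma bounded_outdegree_orientation:
  fixes x y :: "'e \<Rightarrow> 'a"
  assumes "finite M" "\<And>M'. M' \<subseteq> M \<Longrightarrow> card M' \<le> K * card (x ` M' \<union> y ` M')"
  shows "\<exists>T. (\<forall>e \<in> M. T e = x e \<or> T e = y e) \<and> (\<forall>q. card {e \<in> M. T e = q} \<le> 2 * K)"
  using assms
proof (induction "card M" arbitrary: M rule: less_induct)
  case less
  show ?case
  proof (cases "M = {}")
    case True then show ?thesis by simp
  next
    case False
    define Q where "Q = x ` M \<union> y ` M"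
    define deg where "deg q = card {e \<in> M. x e = q} + card {e \<in> M. y e = q}" for q
    have finQ: "finite Q" "Q \<noteq> {}" using less.prems(1) False by (auto simp: Q_def)
    have fibres: "(\<Sum>q \<in> Q. card {e \<in> M. h e = q}) = card M" if "h ` M \<subseteq> Q" for h
      using sum.group[OF less.prems(1) finQ(1) that, of "\<lambda>_. 1 :: nat"] by simp
    have "(\<Sum>q \<in> Q. deg q) = card M + card M"
      unfolding deg_def sum.distrib using fibres[of x] fibres[of y] by (simp add: Q_def)
    also have "\<dots> \<le> (\<Sum>q \<in> Q. 2 * K)" using less.prems(2)[of M] by (simp add: Q_def algebra_simps)
    finally have le: "(\<Sum>q \<in> Q. deg q) \<le> (\<Sum>q \<in> Q. 2 * K)" .
    have "\<exists>q \<in> Q. deg q \<le> 2 * K"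
    proof (rule ccontr)
      assume "\<not> ?thesis"
      then have "(\<Sum>q \<in> Q. 2 * K) < (\<Sum>q \<in> Q. deg q)"
        using finQ by (intro sum_strict_mono) (auto simp: not_le)
      then show False using le by simp
    qed
    then obtain q where q: "q \<in> Q" "deg q \<le> 2 * K" by blast
    define M' where "M' = {e \<in> M. x e \<noteq> q \<and> y e \<noteq> q}"
    have "M' \<subset> M" using q(1) by (auto simp: M'_def Q_def)
    then have M': "card M' < card M" "finite M'" "M' \<subseteq> M"
      using less.prems(1) by (auto intro: psubset_card_mono finite_subset)
    have "\<exists>T. (\<forall>e \<in> M'. T e = x e \<or> T e = y e) \<and> (\<forall>q. card {e \<in> M'. T e = q} \<le> 2 * K)"
      by (rule less.hyps[OF M'(1,2)]) (rule less.prems(2), use M'(3) in blast)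
    then obtain T where T: "\<And>e. e \<in> M' \<Longrightarrow> T e = x e \<or> T e = y e"
        "\<And>r. card {e \<in> M'. T e = r} \<le> 2 * K"
      by blast
    define T' where "T' e = (if e \<in> M' then T e else q)" for e
    have "T' e = x e \<or> T' e = y e" if "e \<in> M" for e
      using T(1) that by (auto simp: T'_def M'_def)
    moreover have "card {e \<in> M. T' e = r} \<le> 2 * K" for r
    proof (cases "r = q")
      case True
      have "{e \<in> M. T' e = r} \<subseteq> {e \<in> M. x e = q} \<union> {e \<in> M. y e = q}"
      proof
        fix e assume "e \<in> {e \<in> M. T' e = r}"
        then show "e \<in> {e \<in> M. x e = q} \<union> {e \<in> M. y e = q}"
          using T(1)[of e] True by (cases "e \<in> M'") (auto simp: T'_def M'_def)
      qed
      then have "card {e \<in> M. T' e = r} \<le> card ({e \<in> M. x e = q} \<union> {e \<in> M. y e = q})"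
        using less.prems(1) by (intro card_mono) auto
      also have "\<dots> \<le> deg q" unfolding deg_def by (rule card_Un_le)
      finally show ?thesis using q(2) by simp
    next
      case False
      then have "{e \<in> M. T' e = r} = {e \<in> M'. T e = r}"
        using M'(3) by (auto simp: T'_def)
      then show ?thesis using T(2) by simp
    qed
    ultimately show ?thesis by blast
  qed
qed

text \<open>
  Vertices are placed one after the other, each on the side that cuts at least half of its edges to
  the vertices already placed.
\<close>

lemma max_cut_half:
  assumes "finite Q" "finite M" "\<And>e. e \<in> M \<Longrightarrow> a e \<in> Q \<and> b e \<in> Q \<and> a e \<noteq> b e"
  shows "\<exists>S. card M \<le> 2 * card {e \<in> M. (a e \<in> S) \<noteq> (b e \<in> S)}"
  using assms
proof (induction Q arbitrary: M)
  case empty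
  then have "M = {}" by auto
  then show ?case by simp
next
  case (insert q Q)
  define M0 where "M0 = {e \<in> M. a e \<noteq> q \<and> b e \<noteq> q}"
  have "M0 \<subseteq> M" by (auto simp: M0_def)
  define oth where "oth e = (if a e = q then b e else a e)" for e
  obtain S where S: "card M0 \<le> 2 * card {e \<in> M0. (a e \<in> S) \<noteq> (b e \<in> S)}"
  proof -
    have "a e \<in> Q \<and> b e \<in> Q \<and> a e \<noteq> b e" if "e \<in> M0" for e
      using that insert.prems(2)[of e] by (auto simp: M0_def)
    then show ?thesis using that insert.IH[of M0] \<open>M0 \<subseteq> M\<close> finite_subset insert.prems(1) by blast
  qed
  define L where "L = {e \<in> M - M0. oth e \<in> S}"
  define R where "R = {e \<in> M - M0. oth e \<notin> S}"
  have "M - M0 = L \<union> R" "L \<inter> R = {}" by (auto simp: L_def R_def)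
  moreover have "finite L" "finite R" using insert.prems(1) by (simp_all add: L_def R_def)
  ultimately have LR: "card (M - M0) = card L + card R" by (simp add: card_Un_disjoint)
  have M: "card M = card M0 + card (M - M0)"
    using card_mono[OF insert.prems(1) \<open>M0 \<subseteq> M\<close>] insert.prems(1) \<open>M0 \<subseteq> M\<close>
    by (simp add: card_Diff_subset finite_subset)
  have cross: "card {e \<in> M. (a e \<in> S') \<noteq> (b e \<in> S')} = card {e \<in> M0. (a e \<in> S) \<noteq> (b e \<in> S)} + card X"
    if agree: "\<And>r. r \<noteq> q \<Longrightarrow> r \<in> S' \<longleftrightarrow> r \<in> S"
      and X: "X = {e \<in> M - M0. (oth e \<in> S) \<noteq> (q \<in> S')}" for S' X
  proof -
    have "(a e \<in> S') \<noteq> (b e \<in> S') \<longleftrightarrow> (a e \<in> S) \<noteq> (b e \<in> S)" if "e \<in> M0" for e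
      using that agree[of "a e"] agree[of "b e"] by (simp add: M0_def)
    moreover have "(a e \<in> S') \<noteq> (b e \<in> S') \<longleftrightarrow> (oth e \<in> S) \<noteq> (q \<in> S')" if "e \<in> M - M0" for e
    proof (cases "a e = q")
      case True
      then have "b e \<noteq> q" using insert.prems(2)[of e] that by auto
      then show ?thesis using True agree[of "b e"] by (auto simp: oth_def)
    next
      case False
      then have "b e = q" using that by (simp add: M0_def)
      then show ?thesis using False agree[of "a e"] by (simp add: oth_def)
    qed
    ultimately have "{e \<in> M. (a e \<in> S') \<noteq> (b e \<in> S')} = {e \<in> M0. (a e \<in> S) \<noteq> (b e \<in> S)} \<union> X"
      using \<open>M0 \<subseteq> M\<close> unfolding X by blast
    moreover have "{e \<in> M0. (a e \<in> S) \<noteq> (b e \<in> S)} \<inter> X = {}" unfolding X by blast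
    ultimately show ?thesis using insert.prems(1) \<open>M0 \<subseteq> M\<close>
      by (simp add: card_Un_disjoint finite_subset[OF _ insert.prems(1)] X)
  qed
  show ?case
  proof (cases "card R \<le> card L")
    case True
    have "L = {e \<in> M - M0. (oth e \<in> S) \<noteq> (q \<in> S - {q})}" by (auto simp: L_def)
    then show ?thesis using cross[of "S - {q}" L] S LR M True by (intro exI[of _ "S - {q}"]) simp
  next
    case False
    have "R = {e \<in> M - M0. (oth e \<in> S) \<noteq> (q \<in> insert q S)}" by (auto simp: R_def)
    then show ?thesis using cross[of "insert q S" R] S LR M False by (intro exI[of _ "insert q S"]) simp
  qed
qed

lemma directed_cut_quarter:
  assumes "finite M" "\<And>e. e \<in> M \<Longrightarrow> a e \<noteq> b e"
  obtains S where "card M \<le> 4 * card {e \<in> M. a e \<in> S \<and> b e \<notin> S}"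
proof -
  obtain S where S: "card M \<le> 2 * card {e \<in> M. (a e \<in> S) \<noteq> (b e \<in> S)}"
    using max_cut_half[of "a ` M \<union> b ` M" M a b] assms by auto
  have "card {e \<in> M. (a e \<in> S) \<noteq> (b e \<in> S)}
      = card ({e \<in> M. a e \<in> S \<and> b e \<notin> S} \<union> {e \<in> M. a e \<in> - S \<and> b e \<notin> - S})"
    by (rule arg_cong[where f = card]) auto
  also have "\<dots> \<le> card {e \<in> M. a e \<in> S \<and> b e \<notin> S} + card {e \<in> M. a e \<in> - S \<and> b e \<notin> - S}"
    by (rule card_Un_le)
  finally have "card M \<le> 4 * card {e \<in> M. a e \<in> S \<and> b e \<notin> S} \<or>
      card M \<le> 4 * card {e \<in> M. a e \<in> - S \<and> b e \<notin> - S}"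
    using S by linarith
  then show ?thesis using that[of S] that[of "- S"] by blast
qed

section \<open>Contracting stars\<close>

definition spoke_bound :: "nat \<Rightarrow> nat" where
  "spoke_bound K = K + K * (1 + K) + (2 * K + 1) * K"

text \<open>
  The heart of the contraction argument.  Each \<open>e\<close> in \<open>N\<close> is an edge between the centres \<open>a e\<close> and \<open>b e\<close>,
  which lie on different sides of a cut.  It is realised by a private interior \<open>I e\<close> that leads from \<open>a e\<close>
  to a port \<open>hd e\<close> of the star of \<open>b e\<close>, and only this port may be shared with other edges.

  Among the edges whose port is not itself a centre, choose a maximal set \<open>D\<close> of chords, a chord being
  a pair of edges with a common port, such that distinct chords have distinct ports and join distinct
  pairs of centres.  Routing a chord through its port makes \<open>D\<close> a topological minor on the centres, so \<open>D\<close>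
  and the set of used ports have size \<open>O (card Z)\<close>.  Edges into used ports form a topological minor on the
  centres and the used ports.  At an unused port, maximality makes any two incoming centres the ends of
  a chord; a clique of chords on \<open>s\<close> vertices has \<open>s * (s - 1) / 2 \<le> K * s\<close> chords, so the
  port receives at most \<open>2 * K + 1\<close> edges.  Keeping one of them per port makes the ports private.
\<close>

lemma card_spokes_le:
  fixes N :: "'e set" and a b hd :: "'e \<Rightarrow> 'a"
  assumes sparse: "sparse E (2 * T + 1) K" and E: "sym E" and fin: "finite Z" "finite N" and S: "S \<subseteq> Z"
    and tails: "\<And>e. e \<in> N \<Longrightarrow> a e \<in> S" and heads: "\<And>e. e \<in> N \<Longrightarrow> b e \<in> Z - S"
    and inj: "\<And>e f. e \<in> N \<Longrightarrow> f \<in> N \<Longrightarrow> a e = a f \<Longrightarrow> b e = b f \<Longrightarrow> e = f"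
    and hd_edge: "\<And>e. e \<in> N \<Longrightarrow> hd e = b e \<or> hd e \<notin> Z \<and> (hd e, b e) \<in> E"
    and hd_b: "\<And>e f. e \<in> N \<Longrightarrow> f \<in> N \<Longrightarrow> hd e = hd f \<Longrightarrow> b e = b f"
    and path: "\<And>e. e \<in> N \<Longrightarrow> finite (I e) \<and> card (I e) \<le> T \<and> I e \<inter> Z = {} \<and> linked E (I e) (a e) (hd e)"
    and disj: "\<And>e f. e \<in> N \<Longrightarrow> f \<in> N \<Longrightarrow> e \<noteq> f \<Longrightarrow> I e \<inter> I f = {}"
    and hd_I: "\<And>e f. e \<in> N \<Longrightarrow> f \<in> N \<Longrightarrow> hd e \<notin> I f"
  shows "card N \<le> spoke_bound K * card Z"
proof -
  have T: "T \<le> 2 * T + 1" "T + 1 \<le> 2 * T + 1" by simp_all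
  have ab: "a e \<in> Z" "b e \<in> Z" "a e \<noteq> b e" "b f \<noteq> a e" if "e \<in> N" "f \<in> N" for e f
    using tails[OF that(1)] heads[OF that(1)] heads[OF that(2)] S by auto
  define N1 where "N1 = {e \<in> N. hd e \<in> Z}"
  define N2 where "N2 = {e \<in> N. hd e \<notin> Z}"
  have N12: "N = N1 \<union> N2" "N1 \<inter> N2 = {}" by (auto simp: N1_def N2_def)
  have finN: "finite N1" "finite N2" using fin(2) by (simp_all add: N1_def N2_def)
  have pathT: "finite (I e)" "card (I e) \<le> T" "I e \<inter> Z = {}" "linked E (I e) (a e) (hd e)" if "e \<in> N" for e
    using path[OF that] by auto

  have card_N1: "card N1 \<le> K * card Z"
  proof (rule sparse_family[OF sparse fin(1) finN(1), where a = a and b = hd and J = I])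
    fix e assume "e \<in> N1"
    then have e: "e \<in> N" "hd e = b e" using hd_edge by (auto simp: N1_def)
    show "a e \<in> Z \<and> hd e \<in> Z \<and> a e \<noteq> hd e" using ab[OF e(1) e(1)] e(2) by auto
    show "finite (I e) \<and> card (I e) \<le> 2 * T + 1 \<and> I e \<inter> Z = {} \<and> linked E (I e) (a e) (hd e)"
      using pathT[OF e(1)] by simp
  next
    fix e f assume *: "e \<in> N1" "f \<in> N1" "{a e, hd e} = {a f, hd f}"
    then have ef: "e \<in> N" "f \<in> N" "hd e = b e" "hd f = b f" using hd_edge by (auto simp: N1_def)
    then have "a e = a f" "b e = b f" using *(3) ab[OF ef(1,2)] ab[OF ef(2,1)] by (auto simp: doubleton_eq_iff)
    then show "e = f" using inj[OF ef(1,2)] by simp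
  next
    fix e f assume "e \<in> N1" "f \<in> N1" "e \<noteq> f"
    then show "I e \<inter> I f = {}" using disj by (simp add: N1_def)
  qed

  \<comment> \<open>A set of chords is good if it uses every port and joins every pair of centres at most once.\<close>
  define good where "good D \<longleftrightarrow> D \<subseteq> {(e, f). e \<in> N2 \<and> f \<in> N2 \<and> e \<noteq> f \<and> hd e = hd f} \<and>
      inj_on (\<lambda>p. hd (fst p)) D \<and> inj_on (\<lambda>p. {a (fst p), a (snd p)}) D" for D
  have "{D. good D} \<subseteq> Pow (N2 \<times> N2)" by (auto simp: good_def)
  then have "finite {D. good D}" using finN(2) by (auto intro: finite_subset)
  moreover have "good {}" by (simp add: good_def)
  ultimately obtain D where "good D" and maximal: "\<And>D'. good D' \<Longrightarrow> D \<subseteq> D' \<Longrightarrow> D = D'"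
    using finite_has_maximal[of "{D. good D}"] by auto
  have D: "e \<in> N" "f \<in> N" "e \<in> N2" "f \<in> N2" "e \<noteq> f" "hd e = hd f" if "(e, f) \<in> D" for e f
    using \<open>good D\<close> that by (auto simp: good_def N2_def)
  have D_hd: "p = q" if "p \<in> D" "q \<in> D" "hd (fst p) = hd (fst q)" for p q
    using \<open>good D\<close> that by (auto simp: good_def dest: inj_onD)
  have D_pair: "p = q" if "p \<in> D" "q \<in> D" "{a (fst p), a (snd p)} = {a (fst q), a (snd q)}" for p q
    using \<open>good D\<close> that unfolding good_def inj_on_def by blast
  have finD: "finite D" using finN(2) D by (intro finite_subset[of D "N2 \<times> N2"]) auto
  define used where "used = (\<lambda>p. hd (fst p)) ` D"

  \<comment> \<open>A chord \<open>(e, f)\<close> runs from \<open>a e\<close> to \<open>a f\<close> through the port that \<open>e\<close> and \<open>f\<close> share.\<close>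
  have chords: "card {p \<in> D. a (fst p) \<in> C \<and> a (snd p) \<in> C} \<le> K * card C" if C: "C \<subseteq> Z" for C
  proof (rule sparse_family[OF sparse, where a = "\<lambda>p. a (fst p)" and b = "\<lambda>p. a (snd p)"
        and J = "\<lambda>p. insert (hd (fst p)) (I (fst p) \<union> I (snd p))"])
    show "finite C" using C fin(1) by (rule finite_subset)
    show "finite {p \<in> D. a (fst p) \<in> C \<and> a (snd p) \<in> C}" using finD by simp
  next
    fix p assume p: "p \<in> {p \<in> D. a (fst p) \<in> C \<and> a (snd p) \<in> C}"
    obtain e f where [simp]: "p = (e, f)" by (cases p)
    have ef: "(e, f) \<in> D" "a e \<in> C" "a f \<in> C" using p by auto
    note ef' = D[OF ef(1)]
    show "a (fst p) \<in> C \<and> a (snd p) \<in> C \<and> a (fst p) \<noteq> a (snd p)"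
      using ef inj[OF ef'(1,2)] hd_b[OF ef'(1,2)] ef' by auto
    let ?J = "insert (hd e) (I e \<union> I f)"
    have "card ?J \<le> Suc (card (I e) + card (I f))"
      using card_Un_le[of "I e" "I f"] pathT ef' by (simp add: card_insert_if)
    then have "card ?J \<le> 2 * T + 1" using pathT(2)[OF ef'(1)] pathT(2)[OF ef'(2)] by simp
    moreover have "?J \<inter> C = {}"
      using pathT(3)[OF ef'(1)] pathT(3)[OF ef'(2)] ef'(3) C by (auto simp: N2_def)
    moreover have "linked E ?J (a e) (hd e)" "linked E ?J (a f) (hd e)"
      using pathT(4)[OF ef'(1)] pathT(4)[OF ef'(2)] ef'(6) by (auto intro: linked_mono)
    then have "linked E ?J (a e) (a f)" using E by (auto intro: linked_trans linked_sym)
    ultimately show "finite (insert (hd (fst p)) (I (fst p) \<union> I (snd p))) \<and>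
        card (insert (hd (fst p)) (I (fst p) \<union> I (snd p))) \<le> 2 * T + 1 \<and>
        insert (hd (fst p)) (I (fst p) \<union> I (snd p)) \<inter> C = {} \<and>
        linked E (insert (hd (fst p)) (I (fst p) \<union> I (snd p))) (a (fst p)) (a (snd p))"
      using pathT(1) ef' by simp
  next
    fix p q assume pq: "p \<in> {p \<in> D. a (fst p) \<in> C \<and> a (snd p) \<in> C}"
      "q \<in> {p \<in> D. a (fst p) \<in> C \<and> a (snd p) \<in> C}"
    show "{a (fst p), a (snd p)} = {a (fst q), a (snd q)} \<Longrightarrow> p = q" using D_pair pq by blast
    obtain e f e' f' where [simp]: "p = (e, f)" "q = (e', f')" by (cases p, cases q)
    have ef: "(e, f) \<in> D" "(e', f') \<in> D" using pq by auto
    note ef1 = D[OF ef(1)] and ef2 = D[OF ef(2)]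
    assume "p \<noteq> q"
    then have hd: "hd e \<noteq> hd e'" using D_hd[OF ef] by auto
    then have "e \<noteq> e'" "e \<noteq> f'" "f \<noteq> e'" "f \<noteq> f'" using ef1 ef2 by auto
    then have "I e \<inter> I e' = {}" "I e \<inter> I f' = {}" "I f \<inter> I e' = {}" "I f \<inter> I f' = {}"
      using disj ef1 ef2 by auto
    then show "insert (hd (fst p)) (I (fst p) \<union> I (snd p)) \<inter> insert (hd (fst q)) (I (fst q) \<union> I (snd q)) = {}"
      using hd hd_I ef1(1,2) ef2(1,2) by auto
  qed

  define N3 where "N3 = {e \<in> N2. hd e \<in> used}"
  define N4 where "N4 = {e \<in> N2. hd e \<notin> used}"
  have N34: "N2 = N3 \<union> N4" "N3 \<inter> N4 = {}" by (auto simp: N3_def N4_def)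
  have finN': "finite N3" "finite N4" using finN by (simp_all add: N3_def N4_def)

  have used: "finite used" "card used \<le> K * card Z"
  proof -
    show "finite used" using finD by (simp add: used_def)
    have "a (fst p) \<in> Z \<and> a (snd p) \<in> Z" if "p \<in> D" for p
      using D(1,2)[of "fst p" "snd p"] that ab(1) by simp
    then have "{p \<in> D. a (fst p) \<in> Z \<and> a (snd p) \<in> Z} = D" by blast
    then show "card used \<le> K * card Z"
      using chords[of Z] card_image_le[OF finD, of "\<lambda>p. hd (fst p)"] by (simp add: used_def)
  qed

  have "card N3 \<le> K * card (Z \<union> used)"
  proof (rule sparse_family[OF sparse, where a = a and b = hd and J = I])
    show "finite (Z \<union> used)" "finite N3" using fin used finN' by simp_all
  next
    fix e assume "e \<in> N3"
    then have e: "e \<in> N" "hd e \<in> used" "hd e \<notin> Z" by (auto simp: N3_def N2_def)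
    show "a e \<in> Z \<union> used \<and> hd e \<in> Z \<union> used \<and> a e \<noteq> hd e" using ab[OF e(1) e(1)] e by auto
    have "hd (fst p) \<notin> I e" if "p \<in> D" for p
      using hd_I[OF D(1)[of "fst p" "snd p"] e(1)] that by simp
    then have "I e \<inter> used = {}" by (auto simp: used_def)
    then show "finite (I e) \<and> card (I e) \<le> 2 * T + 1 \<and> I e \<inter> (Z \<union> used) = {} \<and> linked E (I e) (a e) (hd e)"
      using pathT[OF e(1)] by auto
  next
    fix e f assume *: "e \<in> N3" "f \<in> N3" "{a e, hd e} = {a f, hd f}"
    then have ef: "e \<in> N" "f \<in> N" "hd e \<notin> Z" "hd f \<notin> Z" by (auto simp: N3_def N2_def)
    then have "a e = a f" "hd e = hd f" using *(3) ab by (auto simp: doubleton_eq_iff)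
    then show "e = f" using inj[OF ef(1,2)] hd_b[OF ef(1,2)] by simp
  next
    fix e f assume "e \<in> N3" "f \<in> N3" "e \<noteq> f"
    then show "I e \<inter> I f = {}" using disj by (simp add: N3_def N2_def)
  qed
  also have "\<dots> \<le> K * (card Z + card used)" by (intro mult_le_mono2 card_Un_le)
  also have "\<dots> \<le> K * (card Z + K * card Z)" using used(2) by simp
  finally have card_N3: "card N3 \<le> K * (1 + K) * card Z" by (simp add: algebra_simps)

  have fibre: "card {e \<in> N4. hd e = y} \<le> 2 * K + 1" for y
  proof -
    define F where "F = {e \<in> N4. hd e = y}"
    have F: "e \<in> N" "e \<in> N2" "hd e = y" "y \<notin> used" if "e \<in> F" for e
      using that by (auto simp: F_def N4_def N2_def)
    have inj_a: "inj_on a F"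
    proof (rule inj_onI)
      fix e f assume "e \<in> F" "f \<in> F" "a e = a f"
      then show "e = f" using F[of e] F[of f] inj[of e f] hd_b[of e f] by simp
    qed
    define C where "C = a ` F"
    have C: "C \<subseteq> Z" using F(1) ab(1) by (auto simp: C_def)
    then have finC: "finite C" using fin(1) by (rule finite_subset)
    \<comment> \<open>Any two centres that reach the unused port \<open>y\<close> already span a chord, by maximality of \<open>D\<close>.\<close>
    have "{B. B \<subseteq> C \<and> card B = 2} \<subseteq> (\<lambda>p. {a (fst p), a (snd p)}) ` {p \<in> D. a (fst p) \<in> C \<and> a (snd p) \<in> C}"
    proof
      fix B assume "B \<in> {B. B \<subseteq> C \<and> card B = 2}"
      then obtain u v where B: "B = {u, v}" "u \<noteq> v" "B \<subseteq> C" by (auto simp: card_2_iff)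
      then obtain e f where ef: "e \<in> F" "f \<in> F" "B = {a e, a f}" "e \<noteq> f" by (auto simp: C_def)
      have "\<exists>p \<in> D. B = {a (fst p), a (snd p)}"
      proof (rule ccontr)
        assume *: "\<not> ?thesis"
        have "inj_on (\<lambda>p. hd (fst p)) (insert (e, f) D)"
          using \<open>good D\<close> F[OF ef(1)] by (auto simp: good_def used_def inj_on_insert)
        moreover have "inj_on (\<lambda>p. {a (fst p), a (snd p)}) (insert (e, f) D)"
          using \<open>good D\<close> * ef(3) unfolding good_def inj_on_insert by auto
        ultimately have "good (insert (e, f) D)"
          using \<open>good D\<close> F[OF ef(1)] F[OF ef(2)] ef(4) by (simp add: good_def)
        then have "(e, f) \<in> D" using maximal[of "insert (e, f) D"] by blast
        then show False using * ef(3) by auto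
      qed
      then show "B \<in> (\<lambda>p. {a (fst p), a (snd p)}) ` {p \<in> D. a (fst p) \<in> C \<and> a (snd p) \<in> C}"
        using B(3) by auto
    qed
    then have "card {B. B \<subseteq> C \<and> card B = 2} \<le> card {p \<in> D. a (fst p) \<in> C \<and> a (snd p) \<in> C}"
      by (rule surj_card_le[rotated]) (use finD in simp)
    then have "card C choose 2 \<le> K * card C"
      using chords[OF C] n_subsets[OF finC, of 2] by simp
    moreover have "even (card C * (card C - 1))" by (cases "card C") auto
    then have "card C * (card C - 1) = 2 * (card C choose 2)" by (simp add: choose_two)
    ultimately have "card C * (card C - 1) \<le> 2 * (K * card C)" by simp
    then have "card C * (card C - 1) \<le> card C * (2 * K)" by (simp add: mult_ac)
    then have "card C \<le> 2 * K + 1" by (cases "card C = 0") auto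
    then show ?thesis using card_image[OF inj_a] by (simp add: C_def F_def)
  qed
  obtain N5 where N5: "N5 \<subseteq> N4" "inj_on hd N5" "card N4 \<le> (2 * K + 1) * card N5"
    using select_from_fibres[OF finN'(2), of hd "2 * K + 1"] fibre by blast
  have "card N5 \<le> K * card Z"
  proof (rule sparse_family[OF sparse fin(1), where a = a and b = b and J = "\<lambda>e. insert (hd e) (I e)"])
    show "finite N5" using N5(1) finN'(2) by (rule finite_subset)
  next
    fix e assume "e \<in> N5"
    then have e: "e \<in> N" "hd e \<notin> Z" using N5(1) by (auto simp: N4_def N2_def)
    show "a e \<in> Z \<and> b e \<in> Z \<and> a e \<noteq> b e" using ab[OF e(1) e(1)] by simp
    have "linked E (insert (hd e) (I e)) (a e) (hd e)" using pathT(4)[OF e(1)] by (auto intro: linked_mono)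
    moreover have "linked E (insert (hd e) (I e)) (hd e) (b e)"
      using hd_edge[OF e(1)] e(2) ab(2)[OF e(1) e(1)] by (auto intro: linked.edge)
    ultimately have "linked E (insert (hd e) (I e)) (a e) (b e)" by (auto intro: linked_trans)
    moreover have "card (insert (hd e) (I e)) \<le> Suc (card (I e))" by (rule card_insert_le_m1) simp_all
    ultimately show "finite (insert (hd e) (I e)) \<and> card (insert (hd e) (I e)) \<le> 2 * T + 1 \<and>
        insert (hd e) (I e) \<inter> Z = {} \<and> linked E (insert (hd e) (I e)) (a e) (b e)"
      using pathT[OF e(1)] e(2) by auto
  next
    fix e f assume ef: "e \<in> N5" "f \<in> N5"
    then have N: "e \<in> N" "f \<in> N" using N5(1) by (auto simp: N4_def N2_def)
    show "e = f" if "{a e, b e} = {a f, b f}"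
      using that ab[OF N] ab[OF N(2,1)] inj[OF N] by (auto simp: doubleton_eq_iff)
    assume "e \<noteq> f"
    then have "hd e \<noteq> hd f" "I e \<inter> I f = {}" using N5(2) ef disj[OF N] by (auto dest: inj_onD)
    then show "insert (hd e) (I e) \<inter> insert (hd f) (I f) = {}" using hd_I N by auto
  qed
  then have "card N4 \<le> (2 * K + 1) * (K * card Z)" using N5(3) by (meson le_trans mult_le_mono2)
  moreover have "card N = card N1 + (card N3 + card N4)"
    using N12 N34 finN finN' by (simp add: card_Un_disjoint)
  ultimately show ?thesis using card_N1 card_N3 by (simp add: spoke_bound_def algebra_simps)
qed

definition star_bound :: "nat \<Rightarrow> nat" where
  "star_bound K = 4 * (2 * K + 2 * K * spoke_bound K)"

text \<open>
  Here \<open>\<pi>\<close> maps every vertex to the centre of its star, and \<open>e\<close> is realised by a path between the ports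
  \<open>x e\<close> and \<open>y e\<close>.  The graph of all these paths on the ports is oriented with out-degree at most \<open>2 * K\<close>,
  and a cut that contains a quarter of the edges in the forward direction separates the stars of the
  tails from the stars of the heads.  Edges whose tail is a centre are few.  Of the others one per tail
  is kept; the tail then belongs to the interior of its edge, and what is left is the situation of
  \<open>card_spokes_le\<close>.
\<close>

lemma card_edges_between_stars_le:
  fixes N :: "'e set" and x y :: "'e \<Rightarrow> 'a"
  assumes sparse: "sparse E (2 * T + 3) K" and E: "sym E" and fin: "finite Z" "finite N"
    and star: "\<And>v. \<pi> v = v \<or> (v, \<pi> v) \<in> E" and centre: "\<And>z. z \<in> Z \<Longrightarrow> \<pi> z = z"
    and ends: "\<And>e. e \<in> N \<Longrightarrow> \<pi> (x e) \<in> Z \<and> \<pi> (y e) \<in> Z \<and> \<pi> (x e) \<noteq> \<pi> (y e)"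
    and inj: "\<And>e f. e \<in> N \<Longrightarrow> f \<in> N \<Longrightarrow> {\<pi> (x e), \<pi> (y e)} = {\<pi> (x f), \<pi> (y f)} \<Longrightarrow> e = f"
    and path: "\<And>e. e \<in> N \<Longrightarrow> finite (J e) \<and> card (J e) \<le> T \<and> \<pi> ` J e \<inter> Z = {} \<and> linked E (J e) (x e) (y e)"
    and disj: "\<And>e f. e \<in> N \<Longrightarrow> f \<in> N \<Longrightarrow> e \<noteq> f \<Longrightarrow> J e \<inter> J f = {}"
  shows "card N \<le> star_bound K * card Z"
proof -
  have J: "\<pi> j \<notin> Z" if "e \<in> N" "j \<in> J e" for e j using path[OF that(1)] that(2) by auto
  have "card N' \<le> K * card (x ` N' \<union> y ` N')" if N': "N' \<subseteq> N" for N'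
  proof (rule sparse_family[OF sparse, where a = x and b = y and J = J])
    show "finite (x ` N' \<union> y ` N')" "finite N'" using N' fin(2) by (auto intro: finite_subset)
  next
    fix e assume e: "e \<in> N'"
    then have eN: "e \<in> N" using N' by auto
    show "x e \<in> x ` N' \<union> y ` N' \<and> y e \<in> x ` N' \<union> y ` N' \<and> x e \<noteq> y e" using ends[OF eN] e by auto
    have "J e \<inter> (x ` N' \<union> y ` N') = {}" using J[OF eN] ends N' by blast
    then show "finite (J e) \<and> card (J e) \<le> 2 * T + 3 \<and> J e \<inter> (x ` N' \<union> y ` N') = {} \<and> linked E (J e) (x e) (y e)"
      using path[OF eN] by auto
  next
    fix e f assume *: "e \<in> N'" "f \<in> N'" "{x e, y e} = {x f, y f}"
    then have "(`) \<pi> {x e, y e} = (`) \<pi> {x f, y f}" by simp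
    then show "e = f" using inj[of e f] N' *(1,2) by auto
  next
    fix e f assume "e \<in> N'" "f \<in> N'" "e \<noteq> f"
    then show "J e \<inter> J f = {}" using disj N' by blast
  qed
  then obtain tl where tl: "\<And>e. e \<in> N \<Longrightarrow> tl e = x e \<or> tl e = y e"
      "\<And>q. card {e \<in> N. tl e = q} \<le> 2 * K"
    using bounded_outdegree_orientation[OF fin(2), of K x y] by blast
  define hd where "hd e = (if tl e = x e then y e else x e)" for e
  have tl_hd: "{tl e, hd e} = {x e, y e}" if "e \<in> N" for e
    using tl(1)[OF that] by (auto simp: hd_def)
  define a where "a e = \<pi> (tl e)" for e
  define b where "b e = \<pi> (hd e)" for e
  have ab_set: "{a e, b e} = {\<pi> (x e), \<pi> (y e)}" if "e \<in> N" for e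
    using arg_cong[OF tl_hd[OF that], of "(`) \<pi>"] by (simp add: a_def b_def)
  have ab: "a e \<in> Z" "b e \<in> Z" "a e \<noteq> b e" if "e \<in> N" for e
    using ab_set[OF that] ends[OF that] by (auto simp: doubleton_eq_iff)
  have link: "linked E (J e) (tl e) (hd e)" if "e \<in> N" for e
    using path[OF that] tl(1)[OF that] E by (auto simp: hd_def intro: linked_sym)

  \<comment> \<open>The cut also ensures that no tail lies in the star of a head.\<close>
  obtain S where S: "card N \<le> 4 * card {e \<in> N. a e \<in> S \<and> b e \<notin> S}"
    using directed_cut_quarter[OF fin(2), of a b] ab(3) by blast
  define N' where "N' = {e \<in> N. a e \<in> S \<and> b e \<notin> S}"
  define N1 where "N1 = {e \<in> N'. tl e \<in> Z}"
  define N2 where "N2 = {e \<in> N'. tl e \<notin> Z}"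
  have finN: "finite N'" "finite N1" "finite N2" using fin(2) by (simp_all add: N'_def N1_def N2_def)
  have fibre: "card {e \<in> M. tl e = q} \<le> 2 * K" if "M \<subseteq> N" for M q
  proof -
    have "card {e \<in> M. tl e = q} \<le> card {e \<in> N. tl e = q}" using that fin(2) by (intro card_mono) auto
    then show ?thesis using tl(2)[of q] by simp
  qed
  have "card N1 \<le> 2 * K * card (tl ` N1)"
    by (rule card_le_fibres[OF finN(2)]) (rule fibre, auto simp: N1_def N'_def)
  also have "card (tl ` N1) \<le> card Z" by (rule card_mono[OF fin(1)]) (auto simp: N1_def)
  finally have card_N1: "card N1 \<le> 2 * K * card Z" by simp
  have "N2 \<subseteq> N" by (auto simp: N2_def N'_def)
  obtain M where M: "M \<subseteq> N2" "inj_on tl M" "card N2 \<le> 2 * K * card M"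
    using select_from_fibres[OF finN(3), of tl "2 * K"] fibre[OF \<open>N2 \<subseteq> N\<close>] by blast
  have MN: "e \<in> N" "tl e \<notin> Z" "a e \<in> S" "b e \<notin> S" if "e \<in> M" for e
    using that M(1) by (auto simp: N2_def N'_def)

  have "card M \<le> spoke_bound K * card Z"
  proof (rule card_spokes_le[where T = "T + 1" and S = "S \<inter> Z" and a = a and b = b and hd = hd
        and I = "\<lambda>e. insert (tl e) (J e)"])
    show "sparse E (2 * (T + 1) + 1) K" using sparse by (simp add: numeral_3_eq_3)
    show "finite M" using M(1) finN(3) by (rule finite_subset)
  next
    fix e assume e: "e \<in> M"
    note eN = MN[OF e]
    show "a e \<in> S \<inter> Z" "b e \<in> Z - S \<inter> Z" using ab[OF eN(1)] eN by auto
    show "hd e = b e \<or> hd e \<notin> Z \<and> (hd e, b e) \<in> E"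
      using star[of "hd e"] centre[of "hd e"] by (auto simp: b_def)
    have "(tl e, a e) \<in> E" using star[of "tl e"] ab(1)[OF eN(1)] eN(2) by (auto simp: a_def)
    then have "(a e, tl e) \<in> E" using E by (rule symD[rotated])
    moreover have "linked E (insert (tl e) (J e)) (tl e) (hd e)"
      using link[OF eN(1)] by (rule linked_mono) auto
    ultimately have "linked E (insert (tl e) (J e)) (a e) (hd e)" by (rule linked.step[OF _ insertI1])
    moreover have "j \<notin> Z" if "j \<in> J e" for j using J[OF eN(1) that] centre[of j] by auto
    then have "J e \<inter> Z = {}" by blast
    moreover have "card (insert (tl e) (J e)) \<le> Suc (card (J e))" by (rule card_insert_le_m1) simp_all
    ultimately show "finite (insert (tl e) (J e)) \<and> card (insert (tl e) (J e)) \<le> T + 1 \<and>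
        insert (tl e) (J e) \<inter> Z = {} \<and> linked E (insert (tl e) (J e)) (a e) (hd e)"
      using path[OF eN(1)] eN(2) by auto
  next
    fix e f assume ef: "e \<in> M" "f \<in> M"
    note eN = MN[OF ef(1)] and fN = MN[OF ef(2)]
    show "a e = a f \<Longrightarrow> b e = b f \<Longrightarrow> e = f"
      using inj[OF eN(1) fN(1)] ab_set[OF eN(1)] ab_set[OF fN(1)] by simp
    show "hd e = hd f \<Longrightarrow> b e = b f" by (simp add: b_def)
    have tl_J: "tl e \<notin> J f" "tl f \<notin> J e"
      using J[OF fN(1)] J[OF eN(1)] ab(1)[OF eN(1)] ab(1)[OF fN(1)] by (auto simp: a_def)
    show "insert (tl e) (J e) \<inter> insert (tl f) (J f) = {}" if "e \<noteq> f"
      using that tl_J disj[OF eN(1) fN(1)] M(2) ef by (auto dest: inj_onD)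
    have "hd e \<noteq> tl f" using eN(4) fN(3) by (auto simp: a_def b_def)
    moreover have "hd e \<notin> J f" using J[OF fN(1)] ab(2)[OF eN(1)] by (auto simp: b_def)
    ultimately show "hd e \<notin> insert (tl f) (J f)" by simp
  qed (use E fin in auto)
  then have "card N2 \<le> 2 * K * (spoke_bound K * card Z)" using M(3) by (meson le_trans mult_le_mono2)
  moreover have "card N' = card N1 + card N2"
    using finN by (subst card_Un_disjoint[symmetric]) (auto simp: N1_def N2_def intro: arg_cong[where f = card])
  ultimately have "card N' \<le> (2 * K + 2 * K * spoke_bound K) * card Z"
    using card_N1 by (simp add: algebra_simps)
  then have "4 * card N' \<le> 4 * ((2 * K + 2 * K * spoke_bound K) * card Z)" by (rule mult_le_mono2)
  also have "\<dots> = star_bound K * card Z" by (simp only: star_bound_def mult.assoc)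
  finally show ?thesis using S by (simp only: N'_def)
qed

definition contract :: "('a \<times> 'a) set \<Rightarrow> ('a \<Rightarrow> 'a) \<Rightarrow> ('a \<times> 'a) set" where
  "contract E \<pi> = {(\<pi> a, \<pi> b) | a b. (a, b) \<in> E \<and> \<pi> a \<noteq> \<pi> b}"

lemma contract_sym: "sym E \<Longrightarrow> sym (contract E \<pi>)"
  by (force simp: contract_def sym_def)

lemma contractI: "(a, b) \<in> E \<Longrightarrow> \<pi> a \<noteq> \<pi> b \<Longrightarrow> (\<pi> a, \<pi> b) \<in> contract E \<pi>"
  unfolding contract_def by blast

lemma contract_contract: "contract (contract E \<pi>) \<rho> = contract E (\<lambda>v. \<rho> (\<pi> v))"
proof
  show "contract (contract E \<pi>) \<rho> \<subseteq> contract E (\<lambda>v. \<rho> (\<pi> v))"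
    unfolding contract_def by blast
  show "contract E (\<lambda>v. \<rho> (\<pi> v)) \<subseteq> contract (contract E \<pi>) \<rho>"
  proof
    fix e assume "e \<in> contract E (\<lambda>v. \<rho> (\<pi> v))"
    then obtain a b where ab: "e = (\<rho> (\<pi> a), \<rho> (\<pi> b))" "(a, b) \<in> E" "\<rho> (\<pi> a) \<noteq> \<rho> (\<pi> b)"
      unfolding contract_def by blast
    then have "(\<pi> a, \<pi> b) \<in> contract E \<pi>" by (intro contractI) auto
    then show "e \<in> contract (contract E \<pi>) \<rho>" unfolding ab(1) using ab(3) by (rule contractI)
  qed
qed

text \<open>
  A crude bound on the size of a lifted interior: the at most \<open>t\<close> centres and, for each pair of at most
  \<open>t + 2\<close> contracted vertices, the two ends of one edge of the original relation between their stars.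
\<close>

definition lift_bound :: "nat \<Rightarrow> nat" where
  "lift_bound t = t + 2 * (t + 2)\<^sup>2"

text \<open>
  A walk in the contracted relation lifts edge by edge; two consecutive lifted edges are joined inside
  a star through its centre.
\<close>

lemma linked_contract_lift:
  assumes linked: "linked (contract E \<pi>) I u v" and I: "finite I" "card I \<le> t"
    and star: "\<And>v. \<pi> v = v \<or> (v, \<pi> v) \<in> E" and idem: "\<And>v. \<pi> (\<pi> v) = \<pi> v" and E: "sym E"
  shows "\<exists>x y J. \<pi> x = u \<and> \<pi> y = v \<and> linked E J x y \<and> finite J \<and> card J \<le> lift_bound t \<and> \<pi> ` J \<subseteq> I"
proof -
  \<comment> \<open>One edge of the original relation is fixed for every edge of the contracted one.\<close>
  define repr where "repr p q = (SOME e. e \<in> E \<and> \<pi> (fst e) = p \<and> \<pi> (snd e) = q)" for p q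
  have rep: "(fst (repr p q), snd (repr p q)) \<in> E \<and> \<pi> (fst (repr p q)) = p \<and> \<pi> (snd (repr p q)) = q"
    if pq: "(p, q) \<in> contract E \<pi>" for p q
  proof -
    obtain x y where "(x, y) \<in> E" "\<pi> x = p" "\<pi> y = q" using pq by (auto simp: contract_def)
    then have "\<exists>e. e \<in> E \<and> \<pi> (fst e) = p \<and> \<pi> (snd e) = q" by (intro exI[of _ "(x, y)"]) simp
    then have "repr p q \<in> E \<and> \<pi> (fst (repr p q)) = p \<and> \<pi> (snd (repr p q)) = q"
      unfolding repr_def by (rule someI_ex)
    then show ?thesis by simp
  qed
  define U where "U = insert u (insert v I)"
  define X where "X = (\<lambda>(p, q). fst (repr p q)) ` (U \<times> U)"
  define Y where "Y = (\<lambda>(p, q). snd (repr p q)) ` (U \<times> U)"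
  define J where "J = {j \<in> I \<union> (X \<union> Y). \<pi> j \<in> I}"
  have finU: "finite U" using I by (simp add: U_def)
  have cardU: "card U \<le> t + 2"
    using I by (simp add: U_def card_insert_if)
  have "card X \<le> (t + 2)\<^sup>2" "card Y \<le> (t + 2)\<^sup>2"
  proof -
    have "card (U \<times> U) \<le> (t + 2)\<^sup>2"
      using mult_le_mono[OF cardU cardU] by (simp only: card_cartesian_product power2_eq_square)
    then show "card X \<le> (t + 2)\<^sup>2" "card Y \<le> (t + 2)\<^sup>2"
      unfolding X_def Y_def using finU
      by (auto intro!: order_trans[OF card_image_le] simp del: card_cartesian_product)
  qed
  then have "card (X \<union> Y) \<le> 2 * (t + 2)\<^sup>2" using card_Un_le[of X Y] by simp
  then have "card (I \<union> (X \<union> Y)) \<le> lift_bound t"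
    using card_Un_le[of I "X \<union> Y"] I by (simp add: lift_bound_def)
  moreover have fin: "finite (I \<union> (X \<union> Y))" using I finU by (simp add: X_def Y_def)
  then have "card J \<le> card (I \<union> (X \<union> Y))" by (intro card_mono) (auto simp: J_def)
  ultimately have cardJ: "card J \<le> lift_bound t" by simp
  have to_centre: "linked E J p y" if "\<pi> p = w" "w \<in> J" "linked E J w y" for p w y
    using star[of p] linked.step[OF _ that(2,3), of p] that by auto
  have from_centre: "linked E J w y" if "\<pi> p = w" "p \<in> J" "linked E J p y" for p w y
    using star[of p] linked.step[OF _ that(2,3), of w] that symD[OF E, of p w] by auto
  have "\<exists>x y. x \<in> X \<and> \<pi> x = u' \<and> \<pi> y = v' \<and> linked E J x y"
    if "linked (contract E \<pi>) I u' v'" "u' \<in> U" "v' \<in> U" for u' v'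
    using that
  proof (induction rule: linked.induct)
    case (edge p q)
    have "fst (repr p q) \<in> X" using edge.prems by (auto simp: X_def)
    moreover have "linked E J (fst (repr p q)) (snd (repr p q))"
      using rep[OF edge.hyps] by (intro linked.edge) simp
    ultimately show ?case using rep[OF edge.hyps] by blast
  next
    case (step p w q)
    note e = rep[OF step.hyps(1)]
    have "w \<in> U" using step.hyps(2) by (simp add: U_def)
    then obtain x y where xy: "x \<in> X" "\<pi> x = w" "\<pi> y = q" "linked E J x y"
      using step.IH step.prems by blast
    have "fst (repr p w) \<in> X" "snd (repr p w) \<in> Y" using step.prems \<open>w \<in> U\<close> by (auto simp: X_def Y_def)
    moreover have "w \<in> J" using idem[of x] xy(2) step.hyps(2) by (simp add: J_def)
    moreover have "x \<in> J" using xy step.hyps(2) by (simp add: J_def)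
    moreover have "snd (repr p w) \<in> J" using e step.hyps(2) calculation(2) by (simp add: J_def)
    ultimately have "linked E J (snd (repr p w)) y" "snd (repr p w) \<in> J"
      using e to_centre[of "snd (repr p w)" w y] from_centre[of x w y] xy by simp_all
    then have "linked E J (fst (repr p w)) y"
      using e linked.step[of "fst (repr p w)" "snd (repr p w)"] by blast
    then show ?case using e xy \<open>fst (repr p w) \<in> X\<close> by blast
  qed
  from this[OF linked] obtain x y where "\<pi> x = u" "\<pi> y = v" "linked E J x y"
    by (auto simp: U_def)
  moreover have "\<pi> ` J \<subseteq> I" "finite J" using fin by (auto simp: J_def)
  ultimately show ?thesis using cardJ by (intro exI[of _ x] exI[of _ y] exI[of _ J]) simp
qed

lemma sparse_contract_stars:
  assumes sparse: "sparse E (2 * lift_bound t + 3) K" and E: "sym E"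
    and star: "\<And>v. \<pi> v = v \<or> (v, \<pi> v) \<in> E" and idem: "\<And>v. \<pi> (\<pi> v) = \<pi> v"
  shows "sparse (contract E \<pi>) t (star_bound K)"
  unfolding sparse_def
proof (intro allI impI)
  fix Z M I assume model: "topological_model (contract E \<pi>) t Z M I"
  note Z = topological_modelD(1,3,4)[OF model] and finM = topological_modelD(2)[OF model]
    and path = topological_model_pathD[OF model] and disj = topological_model_disjointD[OF model]
  define lifts where "lifts e x y J \<longleftrightarrow> \<pi> x = fst e \<and> \<pi> y = snd e \<and> linked E J x y \<and> finite J \<and>
      card J \<le> lift_bound t \<and> \<pi> ` J \<subseteq> I e" for e x y J
  have "\<exists>x y J. lifts e x y J" if "e \<in> M" for e
    unfolding lifts_def
    by (rule linked_contract_lift[OF _ _ _ star idem E]) (use path[OF that] in simp_all)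
  then have "\<forall>e \<in> M. \<exists>k. lifts e (fst k) (fst (snd k)) (snd (snd k))"
    by (metis fst_conv snd_conv)
  from bchoice[OF this] obtain k where "\<forall>e \<in> M. lifts e (fst (k e)) (fst (snd (k e))) (snd (snd (k e)))" ..
  moreover define x y J where "x e = fst (k e)" and "y e = fst (snd (k e))" and "J e = snd (snd (k e))" for e
  ultimately have "\<And>e. e \<in> M \<Longrightarrow> lifts e (x e) (y e) (J e)" by simp
  then have lift: "\<And>e. e \<in> M \<Longrightarrow> \<pi> (x e) = fst e \<and> \<pi> (y e) = snd e \<and>
      linked E (J e) (x e) (y e) \<and> finite (J e) \<and> card (J e) \<le> lift_bound t \<and> \<pi> ` J e \<subseteq> I e"
    unfolding lifts_def .
  define Z0 where "Z0 = fst ` M \<union> snd ` M"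
  have Z0: "Z0 \<subseteq> Z" "finite Z0" using Z finM by (auto simp: Z0_def)
  have "card M \<le> star_bound K * card Z0"
  proof (rule card_edges_between_stars_le[OF sparse E Z0(2) finM star, where x = x and y = y and J = J])
    fix z assume "z \<in> Z0"
    then obtain e where "e \<in> M" "z = fst e \<or> z = snd e" by (auto simp: Z0_def)
    then have "z = \<pi> (x e) \<or> z = \<pi> (y e)" using lift[of e] by auto
    then show "\<pi> z = z" using idem by auto
  next
    fix e assume e: "e \<in> M"
    have "fst e \<noteq> snd e" using e Z(3) by (cases e) (auto dest: asymD)
    then show "\<pi> (x e) \<in> Z0 \<and> \<pi> (y e) \<in> Z0 \<and> \<pi> (x e) \<noteq> \<pi> (y e)"
      using lift[OF e] e by (auto simp: Z0_def)
    have "\<pi> ` J e \<inter> Z0 = {}" using lift[OF e] path(3)[OF e] Z0(1) by blast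
    then show "finite (J e) \<and> card (J e) \<le> lift_bound t \<and> \<pi> ` J e \<inter> Z0 = {} \<and> linked E (J e) (x e) (y e)"
      using lift[OF e] by blast
  next
    fix e f assume ef: "e \<in> M" "f \<in> M" "{\<pi> (x e), \<pi> (y e)} = {\<pi> (x f), \<pi> (y f)}"
    then have "{fst e, snd e} = {fst f, snd f}" using lift by simp
    then have "e = f \<or> e = (snd f, fst f)" by (auto simp: doubleton_eq_iff prod_eq_iff)
    then show "e = f" using ef(1,2) Z(3) by (cases f) (auto dest: asymD)
  next
    fix e f assume ef: "e \<in> M" "f \<in> M" "e \<noteq> f"
    have "\<pi> ` J e \<subseteq> I e" "\<pi> ` J f \<subseteq> I f" using lift[OF ef(1)] lift[OF ef(2)] by simp_all
    then show "J e \<inter> J f = {}" using disj[OF ef] by blast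
  qed
  also have "\<dots> \<le> star_bound K * card Z" using card_mono[OF Z(1) Z0(1)] by simp
  finally show "card M \<le> star_bound K * card Z" .
qed

section \<open>Contracting trees of bounded height\<close>

definition contracted_bound :: "(nat \<Rightarrow> nat) \<Rightarrow> nat \<Rightarrow> nat" where
  "contracted_bound g t = star_bound (g (2 * lift_bound t + 3))"

text \<open>
  The function \<open>p\<close> maps a vertex to its parent and \<open>lev\<close> measures the distance to the root, so that \<open>p ^^ d\<close>
  maps every vertex to its root.  Contracting the vertices of the last level into their parents is a
  contraction of stars, and what remains are trees of smaller height.
\<close>

lemma sparse_contract_trees:
  assumes "sym E" "\<And>v. lev v = (0 :: nat) \<Longrightarrow> p v = v"
    "\<And>v n. lev v = Suc n \<Longrightarrow> (v, p v) \<in> E \<and> lev (p v) = n"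
    "\<And>v. lev v \<le> d" "\<And>t. sparse E t (g t)"
  shows "sparse (contract E (p ^^ d)) t ((contracted_bound ^^ d) g t)"
  using assms
proof (induction d arbitrary: E p lev g)
  case 0
  have "contract E (p ^^ 0) \<subseteq> E" by (auto simp: contract_def)
  then have "sparse (contract E (p ^^ 0)) t (g t)" by (rule sparse_subrel[OF 0(5)])
  then show ?case by (simp add: id_def)
next
  case (Suc d)
  note root = Suc.prems(2) and parent = Suc.prems(3)
  \<comment> \<open>The last level is contracted, and its vertices become isolated roots of the remaining forest.\<close>
  define \<pi> where "\<pi> v = (if lev v = Suc d then p v else v)" for v
  define p' where "p' v = (if lev v = Suc d then v else p v)" for v
  define lev' where "lev' v = (if lev v = Suc d then 0 else lev v)" for v
  have p_level: "lev (p v) = lev v - 1" for v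
    using root[of v] parent[of v] by (cases "lev v") auto
  have iter_level: "lev ((p ^^ k) v) = lev v - k" for k v
    by (induction k) (simp_all add: p_level)
  have iter_p': "(p' ^^ k) v = (p ^^ k) v" if "lev v \<le> d" for k v
  proof (induction k)
    case (Suc k)
    have "lev ((p ^^ k) v) \<noteq> Suc d" using that by (simp add: iter_level)
    then show ?case using Suc by (simp add: p'_def)
  qed simp
  have E': "sym (contract E \<pi>)" by (rule contract_sym[OF Suc.prems(1)])
  have "sparse (contract E (\<pi>)) t (contracted_bound g t)" for t
    unfolding contracted_bound_def
  proof (rule sparse_contract_stars[OF Suc.prems(5,1)])
    show "\<pi> v = v \<or> (v, \<pi> v) \<in> E" for v using parent[of v d] by (simp add: \<pi>_def)
    show "\<pi> (\<pi> v) = \<pi> v" for v using p_level[of v] by (simp add: \<pi>_def)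
  qed
  then have sparse': "sparse (contract (contract E \<pi>) (p' ^^ d)) t ((contracted_bound ^^ d) (contracted_bound g) t)"
  proof (rule Suc.IH[where lev = lev', rotated 4])
    show "lev' v = 0 \<Longrightarrow> p' v = v" for v using root[of v] by (simp add: lev'_def p'_def split: if_splits)
    show "lev' v \<le> d" for v using Suc.prems(4)[of v] by (simp add: lev'_def)
    show "(v, p' v) \<in> contract E \<pi> \<and> lev' (p' v) = n" if "lev' v = Suc n" for v n
    proof -
      have v: "lev v = Suc n" "lev v \<noteq> Suc d" using that by (auto simp: lev'_def split: if_splits)
      then have n: "n < d" using Suc.prems(4)[of v] by simp
      have "\<pi> v = v" "\<pi> (p v) = p v" "v \<noteq> p v" using v n parent[OF v(1)] by (auto simp: \<pi>_def)
      then have "(v, p v) \<in> contract E \<pi>"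
        using contractI[of v "p v" E \<pi>] parent[OF v(1)] by simp
      then show ?thesis using v n parent[OF v(1)] by (simp add: p'_def lev'_def)
    qed
  qed (fact E')
  have comp: "(p' ^^ d) (\<pi> v) = (p ^^ Suc d) v" for v
  proof (cases "lev v = Suc d")
    case True
    then have "(p' ^^ d) (p v) = (p ^^ d) (p v)" by (intro iter_p') (simp add: p_level)
    then show ?thesis using True by (simp add: \<pi>_def funpow_Suc_right del: funpow.simps)
  next
    case False
    then have "lev v \<le> d" using Suc.prems(4)[of v] by simp
    then show ?thesis using False root[of "(p ^^ d) v"] by (simp add: \<pi>_def iter_p' iter_level)
  qed
  have "contract (contract E \<pi>) (p' ^^ d) = contract E (\<lambda>v. (p' ^^ d) (\<pi> v))"
    by (rule contract_contract)
  also have "(\<lambda>v. (p' ^^ d) (\<pi> v)) = p ^^ Suc d" using comp by blast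
  finally have "sparse (contract E (p ^^ Suc d)) t ((contracted_bound ^^ d) (contracted_bound g) t)"
    using sparse' by (simp add: o_def)
  moreover have "(contracted_bound ^^ Suc d) g = (contracted_bound ^^ d) (contracted_bound g)"
    by (simp only: funpow_Suc_right o_apply)
  ultimately show ?case by (simp only:)
qed

section \<open>Pair graphs and isomorphisms\<close>

lemma pair_graphI:
  assumes "finite (pverts G)" "parcs G \<subseteq> pverts G \<times> pverts G" "sym (parcs G)" "\<And>v. (v, v) \<notin> parcs G"
  shows "pair_graph G"
proof -
  have "finite (parcs G)" using assms(1,2) by (meson finite_SigmaI finite_subset)
  then show ?thesis using assms by unfold_locales (auto simp: symmetric_def)
qed

lemma pair_graphD:
  assumes "pair_graph G"
  shows "finite (pverts G)" "parcs G \<subseteq> pverts G \<times> pverts G" "sym (parcs G)" "(v, v) \<notin> parcs G"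
    "finite (parcs G)" "pair_wf_digraph G"
proof -
  interpret pair_graph G by fact
  show "finite (pverts G)" "finite (parcs G)" "pair_wf_digraph G"
    by (simp_all add: pair_finite_verts pair_finite_arcs pair_wf_digraph)
  show "parcs G \<subseteq> pverts G \<times> pverts G" by (auto intro: in_arcsD1 in_arcsD2)
  show "sym (parcs G)" by (auto intro: symI arcs_symmetric)
  show "(v, v) \<notin> parcs G" using no_loops' by blast
qed

lemma is_subgraph_iff:
  assumes "pair_wf_digraph G"
  shows "is_subgraph H G \<longleftrightarrow> pair_graph H \<and> pverts H \<subseteq> pverts G \<and> parcs H \<subseteq> parcs G"
  using assms pair_graphD(6)[of H]
  by (auto simp: is_subgraph_def subgraph_def compatible_def wf_digraph_wp_iff)

text \<open>
  Without parallel arcs, an isomorphism is determined by its action on the vertices.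
\<close>

lemma isomorphic_iff:
  assumes "pair_wf_digraph G"
  shows "isomorphic G H \<longleftrightarrow> (\<exists>\<phi>. inj_on \<phi> (pverts G) \<and> pverts H = \<phi> ` pverts G \<and> parcs H = map_prod \<phi> \<phi> ` parcs G)"
proof
  assume "isomorphic G H"
  then obtain f where f: "pre_digraph.digraph_isomorphism (with_proj G) f" "with_proj H = app_iso f (with_proj G)"
    unfolding isomorphic_def digraph_iso_def by blast
  define \<phi> where "\<phi> = iso_verts f"
  have tail_head: "iso_tail f = fst" "iso_head f = snd"
    using arg_cong[OF f(2), of tail] arg_cong[OF f(2), of head] by simp_all
  have "inj_on \<phi> (pverts G)" using f(1) by (simp add: \<phi>_def pre_digraph.digraph_isomorphism_def)
  moreover have "pverts H = \<phi> ` pverts G" using arg_cong[OF f(2), of verts] by (simp add: \<phi>_def)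
  moreover have "iso_arcs f e = map_prod \<phi> \<phi> e" if "e \<in> parcs G" for e
    using f(1) that tail_head by (simp add: \<phi>_def pre_digraph.digraph_isomorphism_def prod_eq_iff)
  then have "iso_arcs f ` parcs G = map_prod \<phi> \<phi> ` parcs G" by (intro image_cong) simp_all
  then have "parcs H = map_prod \<phi> \<phi> ` parcs G" using arg_cong[OF f(2), of arcs] by simp
  ultimately show "\<exists>\<phi>. inj_on \<phi> (pverts G) \<and> pverts H = \<phi> ` pverts G \<and> parcs H = map_prod \<phi> \<phi> ` parcs G"
    by blast
next
  assume "\<exists>\<phi>. inj_on \<phi> (pverts G) \<and> pverts H = \<phi> ` pverts G \<and> parcs H = map_prod \<phi> \<phi> ` parcs G"
  then obtain \<phi> where \<phi>: "inj_on \<phi> (pverts G)" "pverts H = \<phi> ` pverts G" "parcs H = map_prod \<phi> \<phi> ` parcs G"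
    by blast
  define f where "f = \<lparr>iso_verts = \<phi>, iso_arcs = map_prod \<phi> \<phi>, iso_head = snd, iso_tail = fst\<rparr>"
  have "parcs G \<subseteq> pverts G \<times> pverts G"
    using assms by (auto dest: pair_wf_digraph.in_arcsD1 pair_wf_digraph.in_arcsD2)
  then have "inj_on (map_prod \<phi> \<phi>) (parcs G)"
    using map_prod_inj_on[OF \<phi>(1) \<phi>(1)] inj_on_subset by blast
  then have "pre_digraph.digraph_isomorphism (with_proj G) f"
    using \<phi>(1) assms by (simp add: pre_digraph.digraph_isomorphism_def f_def wf_digraph_wp_iff)
  moreover have "with_proj H = app_iso f (with_proj G)"
    using \<phi>(2,3) by (simp add: app_iso_def f_def with_proj_def)
  ultimately show "isomorphic G H" unfolding isomorphic_def digraph_iso_def by blast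
qed

lemma isomorphic_refl: "pair_wf_digraph G \<Longrightarrow> isomorphic G G"
  by (auto simp: isomorphic_iff prod.map_id0 intro!: exI[of _ id])

lemma isomorphic_sym:
  assumes "pair_wf_digraph G" "isomorphic G H"
  shows "isomorphic H G"
  using digraph_iso_swap[of "with_proj G" "with_proj H"] assms by (simp add: isomorphic_def wf_digraph_wp_iff)

lemma isomorphic_sizes:
  assumes "pair_graph G" "isomorphic G H"
  shows "num_edges H \<le> num_edges G" "num_verts H = num_verts G"
proof -
  from assms(2)[unfolded isomorphic_iff[OF pair_graphD(6)[OF assms(1)]]]
  obtain \<phi> where \<phi>: "inj_on \<phi> (pverts G)" "pverts H = \<phi> ` pverts G" "parcs H = map_prod \<phi> \<phi> ` parcs G"
    by blast
  show "num_verts H = num_verts G" using \<phi> by (simp add: num_verts_def card_image)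
  have "{{u, v} | u v. (u, v) \<in> parcs H} \<subseteq> (\<lambda>B. \<phi> ` B) ` {{u, v} | u v. (u, v) \<in> parcs G}"
  proof
    fix B assume "B \<in> {{u, v} | u v. (u, v) \<in> parcs H}"
    then obtain u v where "(u, v) \<in> parcs G" "B = {\<phi> u, \<phi> v}" by (auto simp: \<phi>(3))
    then have "B = \<phi> ` {u, v}" "{u, v} \<in> {{u, v} | u v. (u, v) \<in> parcs G}" by auto
    then show "B \<in> (\<lambda>B. \<phi> ` B) ` {{u, v} | u v. (u, v) \<in> parcs G}" by (rule image_eqI)
  qed
  moreover have "{{u, v} | u v. (u, v) \<in> parcs G} = (\<lambda>e. {fst e, snd e}) ` parcs G" by force
  then have "finite {{u, v} | u v. (u, v) \<in> parcs G}" using pair_graphD(5)[OF assms(1)] by simp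
  ultimately show "num_edges H \<le> num_edges G"
    unfolding num_edges_def by (rule surj_card_le[rotated])
qed

lemma inj_on_edge_set:
  assumes "asym M"
  shows "inj_on (\<lambda>e. {fst e, snd e}) M"
proof (rule inj_onI)
  fix e f assume ef: "e \<in> M" "f \<in> M" "{fst e, snd e} = {fst f, snd f}"
  then have "e = f \<or> e = (snd f, fst f)" by (auto simp: doubleton_eq_iff prod_eq_iff)
  then show "e = f" using ef(1,2) assms by (cases f) (auto dest: asymD)
qed

lemma degree_eq: "degree G v = card {w. (v, w) \<in> parcs G}"
proof -
  have "out_arcs (with_proj G) v = Pair v ` {w. (v, w) \<in> parcs G}"
    by (auto simp: out_arcs_def)
  then show ?thesis by (simp add: degree_def out_degree_def card_image inj_on_def)
qed

lemma sum_degree_le: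
  assumes G: "pair_graph G"
  shows "(\<Sum>v \<in> pverts G. degree G v) \<le> 2 * num_edges G"
proof -
  note finV = pair_graphD(1)[OF G] and finE = pair_graphD(5)[OF G]
  have "finite {w. (v, w) \<in> parcs G}" for v
    using finite_imageI[OF finE, of snd] by (rule finite_subset[rotated]) force
  moreover have "parcs G = (SIGMA v:pverts G. {w. (v, w) \<in> parcs G})"
    using pair_graphD(2)[OF G] by auto
  ultimately have "card (parcs G) = (\<Sum>v \<in> pverts G. degree G v)"
    unfolding degree_eq using card_SigmaI[OF finV, of "\<lambda>v. {w. (v, w) \<in> parcs G}"] by simp
  moreover have "card (parcs G) \<le> 2 * card ((\<lambda>e. {fst e, snd e}) ` parcs G)"
  proof (rule card_le_fibres[OF finE])
    fix q assume "q \<in> (\<lambda>e. {fst e, snd e}) ` parcs G"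
    then obtain u v where q: "q = {u, v}" by blast
    have "{e \<in> parcs G. {fst e, snd e} = q} \<subseteq> {(u, v), (v, u)}"
      by (auto simp: q doubleton_eq_iff)
    then have "card {e \<in> parcs G. {fst e, snd e} = q} \<le> card {(u, v), (v, u)}"
      by (rule card_mono[rotated]) simp
    also have "\<dots> \<le> 2" by (cases "u = v") simp_all
    finally show "card {e \<in> parcs G. {fst e, snd e} = q} \<le> 2" .
  qed
  moreover have "(\<lambda>e. {fst e, snd e}) ` parcs G = {{u, v} | u v. (u, v) \<in> parcs G}" by force
  ultimately show ?thesis by (simp add: num_edges_def)
qed

section \<open>Components and their radius\<close>

lemma relpow_subset:
  fixes R S :: "('a \<times> 'a) set"
  shows "(u, v) \<in> R ^^ n \<Longrightarrow> R \<subseteq> S \<Longrightarrow> (u, v) \<in> S ^^ n"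
  by (induction n arbitrary: v) auto

lemma awalk_relpow:
  assumes "pre_digraph.awalk K u p v" "tail K = fst" "head K = snd" "arcs K \<subseteq> R"
  shows "(u, v) \<in> R ^^ length p"
proof -
  have "set p \<subseteq> R" "pre_digraph.cas K u p v"
    using assms(1,4) by (auto simp: pre_digraph.awalk_def)
  then show ?thesis
  proof (induction p arbitrary: u)
    case Nil
    then show ?case by (simp add: pre_digraph.cas.simps)
  next
    case (Cons e p)
    then have "fst e = u" "(snd e, v) \<in> R ^^ length p"
      using assms(2,3) by (simp_all add: pre_digraph.cas.simps)
    moreover have "(fst e, snd e) \<in> R" using Cons.prems(1) by simp
    ultimately show ?case using relpow_Suc_I2[of u "snd e" R v "length p"] by simp
  qed
qed

lemma relpow_awalk:
  assumes "wf_digraph K" "tail K = fst" "head K = snd" "(u, v) \<in> (arcs K) ^^ n" "v \<in> verts K"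
  shows "\<exists>p. pre_digraph.awalk K u p v \<and> length p = n"
  using assms(4)
proof (induction n arbitrary: u)
  case 0
  then show ?case using assms(5) by (intro exI[of _ "[]"]) (simp add: wf_digraph.awalk_Nil_iff[OF assms(1)])
next
  case (Suc n)
  then obtain w where w: "(u, w) \<in> arcs K" "(w, v) \<in> (arcs K) ^^ n" by (blast dest: relpow_Suc_D2)
  then obtain p where p: "pre_digraph.awalk K w p v" "length p = n" using Suc.IH by blast
  have "u \<in> verts K" using wf_digraph.tail_in_verts[OF assms(1) w(1)] assms(2) by simp
  then have "pre_digraph.awalk K u ((u, w) # p) v"
    using w(1) p(1) assms(2,3) by (simp add: wf_digraph.awalk_Cons_iff[OF assms(1)])
  then show ?case using p(2) by (intro exI[of _ "(u, w) # p"]) simp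
qed

lemma radius_le_imp_centre:
  assumes wf: "wf_digraph K" and tail_head: "tail K = fst" "head K = snd" and radius: "radius K \<le> ereal (real d)"
  shows "\<exists>r \<in> verts K. \<forall>v \<in> verts K. \<exists>n \<le> d. (r, v) \<in> (arcs K) ^^ n"
proof -
  have "radius K < ereal (real d + 1)" by (rule le_less_trans[OF radius]) simp
  then obtain r where r: "r \<in> verts K" "(SUP v \<in> verts K. wf_digraph.\<mu> K (\<lambda>_. 1) r v) < ereal (real d + 1)"
    unfolding radius_def INF_less_iff by blast
  have "\<exists>n \<le> d. (r, v) \<in> (arcs K) ^^ n" if v: "v \<in> verts K" for v
  proof -
    have "wf_digraph.\<mu> K (\<lambda>_. 1) r v \<le> (SUP v \<in> verts K. wf_digraph.\<mu> K (\<lambda>_. 1) r v)"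
      using v by (rule SUP_upper)
    then have "wf_digraph.\<mu> K (\<lambda>_. 1) r v < ereal (real d + 1)" using r(2) by (rule le_less_trans)
    then obtain p where p: "pre_digraph.awalk K r p v" "wf_digraph.awalk_cost (\<lambda>_. 1) p < real d + 1"
      unfolding wf_digraph.\<mu>_def[OF wf] INF_less_iff by auto
    have "wf_digraph.awalk_cost (\<lambda>_. 1) p = real (length p)" by (induction p) (simp_all add: wf_digraph.awalk_cost_def[OF wf])
    then have "length p \<le> d" using p(2) by simp
    then show ?thesis using awalk_relpow[OF p(1) tail_head order_refl] by blast
  qed
  then show ?thesis using r(1) by blast
qed

lemma radius_le_if_centre:
  assumes wf: "wf_digraph K" and tail_head: "tail K = fst" "head K = snd" and r: "r \<in> verts K"
    and near: "\<And>v. v \<in> verts K \<Longrightarrow> \<exists>n \<le> d. (r, v) \<in> (arcs K) ^^ n"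
  shows "radius K \<le> ereal (real d)"
  unfolding radius_def
proof (rule INF_lower2[OF r], rule SUP_least)
  fix v assume v: "v \<in> verts K"
  then obtain n where "n \<le> d" "(r, v) \<in> (arcs K) ^^ n" using near by blast
  then obtain p where p: "pre_digraph.awalk K r p v" "length p = n"
    using relpow_awalk[OF wf tail_head _ v] by blast
  have "wf_digraph.\<mu> K (\<lambda>_. 1) r v \<le> ereal (wf_digraph.awalk_cost (\<lambda>_. 1) p)"
    by (rule wf_digraph.min_cost_le_walk_cost[OF wf p(1)])
  also have "wf_digraph.awalk_cost (\<lambda>_. 1) p = real (length p)" by (induction p) (simp_all add: wf_digraph.awalk_cost_def[OF wf])
  also have "ereal (real (length p)) \<le> ereal (real d)" using p(2) \<open>n \<le> d\<close> by simp
  finally show "wf_digraph.\<mu> K (\<lambda>_. 1) r v \<le> ereal (real d)" .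
qed

text \<open>
  Closure under adjacency holds because reachability in a symmetric digraph is symmetric: strong
  components are connected components.
\<close>

lemma component_structure:
  assumes X: "pair_graph X" and K: "K \<in> components X"
  shows "wf_digraph K" "tail K = fst" "head K = snd" "arcs K \<subseteq> parcs X" "verts K \<subseteq> pverts X"
    "\<And>u v. u \<in> verts K \<Longrightarrow> (u, v) \<in> parcs X \<Longrightarrow> v \<in> verts K"
    "arcs K = parcs X \<inter> verts K \<times> verts K"
proof -
  interpret pair_graph X by fact
  have K': "K \<in> pre_digraph.sccs (with_proj X)" using K by (simp add: components_def)
  have ind: "induced_subgraph K (with_proj X)"
    using K' by (auto simp: pre_digraph.sccs_def)
  then have sub: "subgraph K (with_proj X)" by (simp add: induced_subgraph_def)
  then show "wf_digraph K" "tail K = fst" "head K = snd" "arcs K \<subseteq> parcs X" "verts K \<subseteq> pverts X"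
    by (simp_all add: subgraph_def compatible_def)
  have "arcs K = {e \<in> parcs X. fst e \<in> verts K \<and> snd e \<in> verts K}"
    using ind unfolding induced_subgraph_def by simp
  also have "\<dots> = parcs X \<inter> verts K \<times> verts K" by force
  finally show "arcs K = parcs X \<inter> verts K \<times> verts K" .
  have "verts K \<in> pre_digraph.sccs_verts (with_proj X)" using K' sccs_verts_conv by blast
  then obtain w where w: "verts K = pre_digraph.scc_of (with_proj X) w" using sccs_verts_conv_scc_of by auto
  show "v \<in> verts K" if "u \<in> verts K" "(u, v) \<in> parcs X" for u v
  proof -
    have "reachable (with_proj X) w u" using that(1) w by (simp add: scc_of_def)
    moreover have "reachable (with_proj X) u v" using that(2) by (intro reachable_adjI) simp
    ultimately have "reachable (with_proj X) w v" by (rule reachable_trans)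
    then have "v \<in> pre_digraph.scc_of (with_proj X) w" by (rule scc_ofI_reachable')
    then show ?thesis using w by simp
  qed
qed

lemma verts_components:
  assumes "pair_graph X"
  shows "verts ` components X = pre_digraph.scc_of (with_proj X) ` pverts X"
proof -
  interpret pair_graph X by fact
  show ?thesis unfolding components_def using sccs_verts_conv sccs_verts_conv_scc_of by simp
qed

lemma components_cover:
  assumes "pair_graph X"
  shows "\<Union> (verts ` components X) = pverts X"
proof -
  interpret pair_graph X by fact
  have "scc_of v \<subseteq> pverts X" if "v \<in> pverts X" for v
    by (rule sccs_verts_subsets[OF scc_of_in_sccs_verts[OF that]])
  then have "(\<Union>v \<in> pverts X. scc_of v) = pverts X" using in_scc_of_self by blast
  then show ?thesis by (simp add: verts_components[OF assms])
qed

lemma components_disjoint: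
  assumes "pair_graph X" "K \<in> components X" "L \<in> components X" "v \<in> verts K" "v \<in> verts L"
  shows "K = L"
proof -
  interpret pair_graph X by fact
  show ?thesis using scc_disj[of K L] assms(2-5) by (auto simp: components_def)
qed

section \<open>Density of shallow minors\<close>

text \<open>
  Breadth-first search from a centre of each component.  Vertices outside of \<open>X\<close> become roots, as
  they are not contracted.
\<close>

lemma rooted_forest_of_shallow_components:
  assumes X: "pair_graph X" and radius: "\<And>K. K \<in> components X \<Longrightarrow> radius K \<le> ereal (real d)"
  obtains lev :: "'a \<Rightarrow> nat" and p :: "'a \<Rightarrow> 'a" where
    "\<And>v. lev v = 0 \<Longrightarrow> p v = v" "\<And>v n. lev v = Suc n \<Longrightarrow> (v, p v) \<in> parcs X \<and> lev (p v) = n" "\<And>v. lev v \<le> d"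
    "\<And>v. v \<notin> pverts X \<Longrightarrow> (p ^^ d) v = v"
    "\<And>K. K \<in> components X \<Longrightarrow> \<exists>r \<in> verts K. \<forall>v \<in> verts K. (p ^^ d) v = r"
proof -
  let ?R = "parcs X"
  have "\<forall>K \<in> components X. \<exists>r. r \<in> verts K \<and> (\<forall>v \<in> verts K. \<exists>n \<le> d. (r, v) \<in> ?R ^^ n)"
  proof
    fix K assume K: "K \<in> components X"
    note c = component_structure[OF X K]
    obtain r where r: "r \<in> verts K" "\<forall>v \<in> verts K. \<exists>n \<le> d. (r, v) \<in> arcs K ^^ n"
      using radius_le_imp_centre[OF c(1-3) radius[OF K]] by blast
    have "(r, v) \<in> ?R ^^ n" if "(r, v) \<in> arcs K ^^ n" for v n
      using that c(4) by (rule relpow_subset)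
    then show "\<exists>r. r \<in> verts K \<and> (\<forall>v \<in> verts K. \<exists>n \<le> d. (r, v) \<in> ?R ^^ n)" using r by blast
  qed
  from bchoice[OF this] obtain c where
    c: "\<forall>K \<in> components X. c K \<in> verts K \<and> (\<forall>v \<in> verts K. \<exists>n \<le> d. (c K, v) \<in> ?R ^^ n)" ..
  \<comment> \<open>Outside of \<open>X\<close> every vertex is its own centre.\<close>
  define cen where "cen v = (if v \<in> pverts X then c (THE K. K \<in> components X \<and> v \<in> verts K) else v)" for v
  have cen: "cen v = c K" if K: "K \<in> components X" "v \<in> verts K" for v K
  proof -
    have "(THE K. K \<in> components X \<and> v \<in> verts K) = K"
      using K components_disjoint[OF X] by (intro the_equality) blast+
    then show ?thesis using K component_structure(5)[OF X] by (auto simp: cen_def)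
  qed
  have near: "\<exists>n \<le> d. (cen v, v) \<in> ?R ^^ n" for v
  proof (cases "v \<in> pverts X")
    case True
    then obtain K where "K \<in> components X" "v \<in> verts K" using components_cover[OF X] by blast
    then show ?thesis using c cen by auto
  next
    case False
    then show ?thesis by (intro exI[of _ 0]) (simp add: cen_def)
  qed
  have cen_arc: "cen u = cen v" if "(u, v) \<in> ?R" for u v
  proof -
    have "u \<in> pverts X" using that pair_graphD(2)[OF X] by auto
    then obtain K where K: "K \<in> components X" "u \<in> verts K" using components_cover[OF X] by blast
    then show ?thesis using cen[OF K] cen[OF K(1) component_structure(6)[OF X K that]] by simp
  qed
  define lev where "lev v = (LEAST n. (cen v, v) \<in> ?R ^^ n)" for v
  have lev: "(cen v, v) \<in> ?R ^^ lev v" "\<And>n. (cen v, v) \<in> ?R ^^ n \<Longrightarrow> lev v \<le> n" for v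
    unfolding lev_def using near[of v] by (auto intro: LeastI Least_le)
  have lev_d: "lev v \<le> d" for v using near[of v] lev(2)[of v] le_trans by blast
  have parent: "\<exists>u. (u, v) \<in> ?R \<and> lev u = n" if "lev v = Suc n" for v n
  proof -
    have "(cen v, v) \<in> ?R ^^ Suc n" using lev(1)[of v] that by simp
    then obtain u where u: "(cen v, u) \<in> ?R ^^ n" "(u, v) \<in> ?R" by (rule relpow_Suc_E)
    have "cen u = cen v" using cen_arc[OF u(2)] .
    then have "lev u \<le> n" using lev(2)[of u n] u(1) by simp
    moreover have "(cen v, v) \<in> ?R ^^ Suc (lev u)"
      using relpow_Suc_I[OF lev(1)[of u] u(2)] \<open>cen u = cen v\<close> by simp
    then have "Suc n \<le> Suc (lev u)" using lev(2)[of v "Suc (lev u)"] that by simp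
    ultimately show ?thesis using u(2) by auto
  qed
  define p where "p v = (if lev v = 0 then v else SOME u. (u, v) \<in> ?R \<and> Suc (lev u) = lev v)" for v
  have p0: "p v = v" if "lev v = 0" for v using that by (simp add: p_def)
  have p1: "(p v, v) \<in> ?R \<and> lev (p v) = n" if "lev v = Suc n" for v n
  proof -
    have "(SOME u. (u, v) \<in> ?R \<and> Suc (lev u) = lev v, v) \<in> ?R \<and>
        Suc (lev (SOME u. (u, v) \<in> ?R \<and> Suc (lev u) = lev v)) = lev v"
      by (rule someI_ex) (use parent[OF that] that in auto)
    then show ?thesis using that by (simp add: p_def)
  qed
  have p1': "(v, p v) \<in> ?R \<and> lev (p v) = n" if "lev v = Suc n" for v n
    using p1[OF that] pair_graphD(3)[OF X] by (auto dest: symD)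
  have cen_p: "cen (p v) = cen v" for v
    using p0[of v] p1[of v] cen_arc by (cases "lev v") auto
  have lev_p: "lev (p v) = lev v - 1" for v
    using p0[of v] p1[of v] by (cases "lev v") auto
  have iter: "cen ((p ^^ k) v) = cen v" "lev ((p ^^ k) v) = lev v - k" for k v
    by (induction k) (simp_all add: cen_p lev_p)
  have root: "(p ^^ d) v = cen v" for v
  proof -
    have "lev ((p ^^ d) v) = 0" using iter(2) lev_d[of v] by simp
    then show ?thesis using lev(1)[of "(p ^^ d) v"] iter(1)[of d v] by simp
  qed
  show ?thesis
  proof (rule that[of lev p, OF p0 p1' lev_d])
    show "(p ^^ d) v = v" if "v \<notin> pverts X" for v using that by (simp add: root cen_def)
    show "\<exists>r \<in> verts K. \<forall>v \<in> verts K. (p ^^ d) v = r" if "K \<in> components X" for K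
      using c cen[OF that] that by (auto simp: root)
  qed
qed

text \<open>
  A graph whose vertices are mapped injectively into a sparse relation is itself sparse.  It serves
  to pass from contracted vertex sets to the roots that represent them.
\<close>

lemma num_edges_le_if_sparse_map:
  assumes K: "pair_graph K" and sparse: "sparse E 0 k" and inj: "inj_on \<rho> (pverts K)"
    and edges: "\<And>A B. (A, B) \<in> parcs K \<Longrightarrow> (\<rho> A, \<rho> B) \<in> E"
  shows "num_edges K \<le> k * num_verts K"
proof -
  define N where "N = {{A, B} | A B. (A, B) \<in> parcs K}"
  have "N = (\<lambda>e. {fst e, snd e}) ` parcs K" by (force simp: N_def)
  then have finN: "finite N" using pair_graphD(5)[OF K] by simp
  have "\<forall>e \<in> N. \<exists>ab. e = {fst ab, snd ab} \<and> ab \<in> parcs K" by (force simp: N_def)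
  from bchoice[OF this] obtain ab where ab: "\<forall>e \<in> N. e = {fst (ab e), snd (ab e)} \<and> ab e \<in> parcs K" ..
  have V: "fst (ab e) \<in> pverts K" "snd (ab e) \<in> pverts K" "fst (ab e) \<noteq> snd (ab e)" if "e \<in> N" for e
  proof -
    have "(fst (ab e), snd (ab e)) \<in> parcs K" using ab that by simp
    then show "fst (ab e) \<in> pverts K" "snd (ab e) \<in> pverts K" "fst (ab e) \<noteq> snd (ab e)"
      using pair_graphD(2,4)[OF K] by auto
  qed
  have "card N \<le> k * card (\<rho> ` pverts K)"
  proof (rule sparse_family[OF sparse _ finN, where a = "\<lambda>e. \<rho> (fst (ab e))" and b = "\<lambda>e. \<rho> (snd (ab e))"
        and J = "\<lambda>_. {}"])
    show "finite (\<rho> ` pverts K)" using pair_graphD(1)[OF K] by simp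
  next
    fix e assume e: "e \<in> N"
    show "\<rho> (fst (ab e)) \<in> \<rho> ` pverts K \<and> \<rho> (snd (ab e)) \<in> \<rho> ` pverts K \<and> \<rho> (fst (ab e)) \<noteq> \<rho> (snd (ab e))"
      using V[OF e] inj by (auto dest: inj_onD)
    have "linked E {} (\<rho> (fst (ab e))) (\<rho> (snd (ab e)))"
      by (rule linked.edge, rule edges) (use ab e in simp)
    then show "finite {} \<and> card {} \<le> 0 \<and> {} \<inter> \<rho> ` pverts K = {} \<and> linked E {} (\<rho> (fst (ab e))) (\<rho> (snd (ab e)))"
      by simp
  next
    fix e f assume ef: "e \<in> N" "f \<in> N"
      "{\<rho> (fst (ab e)), \<rho> (snd (ab e))} = {\<rho> (fst (ab f)), \<rho> (snd (ab f))}"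
    have e: "e = {fst (ab e), snd (ab e)}" and f: "f = {fst (ab f), snd (ab f)}" using ab ef(1,2) by blast+
    have "\<rho> ` {fst (ab e), snd (ab e)} = \<rho> ` {fst (ab f), snd (ab f)}" using ef(3) by simp
    then have "\<rho> ` e = \<rho> ` f" using e f by metis
    moreover have "{fst (ab e), snd (ab e)} \<subseteq> pverts K" "{fst (ab f), snd (ab f)} \<subseteq> pverts K"
      using V[OF ef(1)] V[OF ef(2)] by simp_all
    then have "e \<subseteq> pverts K" "f \<subseteq> pverts K" using e f by metis+
    ultimately show "e = f" using inj by (simp add: inj_on_image_eq_iff)
  qed simp
  also have "card (\<rho> ` pverts K) = card (pverts K)" by (rule card_image[OF inj])
  finally show ?thesis by (simp add: num_edges_def num_verts_def N_def)
qed

lemma num_edges_shallow_minor_le: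
  assumes G: "pair_graph G" and minor: "shallow_minor d H G" and sparse: "\<And>t. sparse (parcs G) t (g t)"
  shows "num_edges H \<le> (contracted_bound ^^ d) g 0 * num_verts H"
proof -
  obtain X K where X: "is_subgraph X G" "\<And>L. L \<in> components X \<Longrightarrow> radius L \<le> ereal (real d)"
    and K: "is_subgraph K (contract_components G X)" and iso: "isomorphic K H"
    using minor unfolding shallow_minor_def by blast
  have X': "pair_graph X" "parcs X \<subseteq> parcs G"
    using X(1) is_subgraph_iff[OF pair_graphD(6)[OF G]] by auto
  obtain lev p where forest: "\<And>v. lev v = (0 :: nat) \<Longrightarrow> p v = v"
      "\<And>v n. lev v = Suc n \<Longrightarrow> (v, p v) \<in> parcs X \<and> lev (p v) = n" "\<And>v. lev v \<le> d"
      "\<And>v. v \<notin> pverts X \<Longrightarrow> (p ^^ d) v = v"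
      "\<And>L. L \<in> components X \<Longrightarrow> \<exists>r \<in> verts L. \<forall>v \<in> verts L. (p ^^ d) v = r"
    using rooted_forest_of_shallow_components[OF X'(1) X(2)] by blast
  define root where "root = p ^^ d"
  have sparse_root: "sparse (contract (parcs G) root) 0 ((contracted_bound ^^ d) g 0)"
    unfolding root_def
  proof (rule sparse_contract_trees[where lev = lev])
    show "(v, p v) \<in> parcs G \<and> lev (p v) = n" if "lev v = Suc n" for v n
      using forest(2)[OF that] X'(2) by auto
  qed (use forest pair_graphD(3)[OF G] sparse in auto)
  define V where "V = verts ` components X \<union> {{v} | v. v \<in> pverts G - pverts X}"
  have contract: "pverts (contract_components G X) = V"
      "parcs (contract_components G X) =
        {(A, B). A \<in> V \<and> B \<in> V \<and> A \<noteq> B \<and> (\<exists>a \<in> A. \<exists>b \<in> B. (a, b) \<in> parcs G)}"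
    by (simp_all add: contract_components_def V_def Let_def)
  have K': "pair_graph K" "pverts K \<subseteq> V" "parcs K \<subseteq> parcs (contract_components G X)"
    using K by (auto simp: is_subgraph_def subgraph_def contract(1))
  have "\<exists>r \<in> A. \<forall>v \<in> A. root v = r" if "A \<in> V" for A
    using that forest(4,5) by (auto simp: V_def root_def)
  then have "\<forall>A \<in> V. \<exists>r. r \<in> A \<and> (\<forall>v \<in> A. root v = r)" by blast
  \<comment> \<open>The representative of a contracted vertex set is the root of its tree.\<close>
  from bchoice[OF this] obtain \<rho> where \<rho>: "\<forall>A \<in> V. \<rho> A \<in> A \<and> (\<forall>v \<in> A. root v = \<rho> A)" ..
  have disj: "A = B" if AB: "A \<in> V" "B \<in> V" "v \<in> A" "v \<in> B" for A B v
  proof (cases "v \<in> pverts X")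
    case True
    then obtain L L' where "L \<in> components X" "A = verts L" "L' \<in> components X" "B = verts L'"
      using AB unfolding V_def by blast
    then show ?thesis using components_disjoint[OF X'(1)] AB(3,4) by blast
  next
    case False
    have "C = {v}" if "C \<in> V" "v \<in> C" for C
      using that False component_structure(5)[OF X'(1)] unfolding V_def by blast
    then show ?thesis using AB by blast
  qed
  have inj: "inj_on \<rho> V"
  proof (rule inj_onI)
    fix A B assume AB: "A \<in> V" "B \<in> V" "\<rho> A = \<rho> B"
    have "\<rho> A \<in> A" "\<rho> B \<in> B" using \<rho> AB(1,2) by blast+
    then show "A = B" using disj[OF AB(1,2), of "\<rho> A"] AB(3) by simp
  qed
  have "num_edges K \<le> (contracted_bound ^^ d) g 0 * num_verts K"
  proof (rule num_edges_le_if_sparse_map[OF K'(1) sparse_root])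
    show "inj_on \<rho> (pverts K)" using inj K'(2) by (rule inj_on_subset)
    fix A B assume "(A, B) \<in> parcs K"
    then have "(A, B) \<in> parcs (contract_components G X)" using K'(3) by blast
    then have "A \<in> V \<and> B \<in> V \<and> A \<noteq> B \<and> (\<exists>a \<in> A. \<exists>b \<in> B. (a, b) \<in> parcs G)"
      unfolding contract(2) by simp
    then obtain a b where AB: "A \<in> V" "B \<in> V" "A \<noteq> B" "a \<in> A" "b \<in> B" "(a, b) \<in> parcs G" by blast
    have "root a = \<rho> A" using bspec[OF \<rho> AB(1)] AB(4) by blast
    moreover have "root b = \<rho> B" using bspec[OF \<rho> AB(2)] AB(5) by blast
    moreover have "\<rho> A \<noteq> \<rho> B" using inj_onD[OF inj _ AB(1,2)] AB(3) by blast
    ultimately show "(\<rho> A, \<rho> B) \<in> contract (parcs G) root"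
      using contractI[OF AB(6), of root] by simp
  qed
  then show ?thesis using isomorphic_sizes[OF K'(1) iso] by simp
qed

text \<open>
  It is essential that \<open>g\<close> does not depend on the graph: the bound at depth \<open>d\<close> is obtained from \<open>g\<close> alone.
\<close>

lemma bounded_expansion_if_uniformly_sparse:
  assumes \<C>: "\<And>G. G \<in> \<C> \<Longrightarrow> pair_graph G" and sparse: "\<And>G t. G \<in> \<C> \<Longrightarrow> sparse (parcs G) t (g t)"
  shows "bounded_expansion \<C>"
  unfolding bounded_expansion_def
proof (intro exI allI)
  fix d
  show "nabla d \<C> \<le> ereal (real ((contracted_bound ^^ d) g 0))"
    unfolding nabla_def
  proof (rule Sup_least, clarify)
    fix H :: "nat pair_pre_digraph" and G
    assume H: "pverts H \<noteq> {}" "shallow_minor d H G" and G: "G \<in> \<C>"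
    have "pair_graph H" using H(2) by (simp add: shallow_minor_def)
    then have n: "0 < real (num_verts H)"
      using H(1) pair_graphD(1) by (simp add: num_verts_def card_gt_0_iff)
    have "num_edges H \<le> (contracted_bound ^^ d) g 0 * num_verts H"
      by (rule num_edges_shallow_minor_le[OF \<C>[OF G] H(2) sparse[OF G]])
    then have "real (num_edges H) \<le> real ((contracted_bound ^^ d) g 0) * real (num_verts H)"
      by (metis of_nat_mono of_nat_mult)
    then show "ereal (density H) \<le> ereal (real ((contracted_bound ^^ d) g 0))"
      using n by (simp add: density_def pos_divide_le_eq)
  qed
qed

section \<open>Topological minors are minors\<close>

text \<open>
  The usual description of minors by branch sets.  The components of the union of the subgraphs
  induced by the branch sets are exactly these subgraphs, since each of them is connected through its
  centre.
\<close>

lemma shallow_minor_if_branch_sets: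
  fixes G :: "'a pair_pre_digraph" and H :: "'b pair_pre_digraph"
  assumes G: "pair_graph G" and H: "pair_graph H"
    and B_G: "\<And>u. u \<in> pverts H \<Longrightarrow> B u \<subseteq> pverts G"
    and centre: "\<And>u. u \<in> pverts H \<Longrightarrow> c u \<in> B u"
    and disj: "\<And>u v. u \<in> pverts H \<Longrightarrow> v \<in> pverts H \<Longrightarrow> u \<noteq> v \<Longrightarrow> B u \<inter> B v = {}"
    and near: "\<And>u x. u \<in> pverts H \<Longrightarrow> x \<in> B u \<Longrightarrow> \<exists>n \<le> d. (c u, x) \<in> (parcs G \<inter> B u \<times> B u) ^^ n"
    and edges: "\<And>u v. (u, v) \<in> parcs H \<Longrightarrow> \<exists>a \<in> B u. \<exists>b \<in> B v. (a, b) \<in> parcs G"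
  shows "shallow_minor d H G"
proof -
  define X where "X = \<lparr>pverts = (\<Union>u \<in> pverts H. B u), parcs = (\<Union>u \<in> pverts H. parcs G \<inter> B u \<times> B u)\<rparr>"
  have X: "pair_graph X"
  proof (rule pair_graphI)
    have "pverts X \<subseteq> pverts G" using B_G by (auto simp: X_def)
    then show "finite (pverts X)" using pair_graphD(1)[OF G] by (rule finite_subset)
    show "sym (parcs X)"
      using pair_graphD(3)[OF G] by (intro symI) (auto simp: X_def dest: symD)
    show "(v, v) \<notin> parcs X" for v using pair_graphD(4)[OF G] by (auto simp: X_def)
  qed (auto simp: X_def)
  interpret X: pair_graph X by (fact X)
  have X_G: "is_subgraph X G"
    using X B_G by (auto simp: is_subgraph_iff[OF pair_graphD(6)[OF G]] X_def)
  have stay: "y \<in> B u" if "(x, y) \<in> (parcs X)\<^sup>*" "x \<in> B u" "u \<in> pverts H" for x y u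
    using that(1)
  proof (induction rule: rtrancl_induct)
    case (step y z)
    then obtain v where v: "v \<in> pverts H" "y \<in> B v" "z \<in> B v" by (auto simp: X_def)
    then have "v = u" using step.IH disj[OF v(1) that(3)] by blast
    then show ?case using v(3) by simp
  qed (fact that(2))
  have reach: "reachable (with_proj X) (c u) x" if xu: "x \<in> B u" "u \<in> pverts H" for x u
  proof -
    obtain n where "(c u, x) \<in> (parcs G \<inter> B u \<times> B u) ^^ n" using near[OF xu(2,1)] by blast
    then have "(c u, x) \<in> (arcs (with_proj X)) ^^ n"
      by (rule relpow_subset) (use xu(2) in \<open>auto simp: X_def\<close>)
    moreover have "x \<in> verts (with_proj X)" using xu by (auto simp: X_def)
    moreover have "wf_digraph (with_proj X)" using pair_graphD(6)[OF X] by (simp add: wf_digraph_wp_iff)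
    ultimately have "\<exists>p. pre_digraph.awalk (with_proj X) (c u) p x \<and> length p = n"
      by (intro relpow_awalk) simp_all
    then show ?thesis using X.reachable_awalkI by blast
  qed
  have scc: "X.scc_of x = B u" if "x \<in> B u" "u \<in> pverts H" for x u
  proof (intro equalityI subsetI)
    fix y assume "y \<in> X.scc_of x"
    then have "reachable (with_proj X) x y" by (simp add: X.scc_of_def)
    then have "(x, y) \<in> (arcs_ends (with_proj X))\<^sup>*" by (rule reachable_rtranclI)
    then have "(x, y) \<in> (parcs X)\<^sup>*" by simp
    then show "y \<in> B u" using that by (rule stay)
  next
    fix y assume "y \<in> B u"
    then have "y \<in> X.scc_of (c u)" using reach that(2) X.scc_ofI_reachable' by blast
    moreover have "X.scc_of (c u) = X.scc_of x"
      using reach[OF that] X.scc_ofI_reachable X.scc_of_eq by blast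
    ultimately show "y \<in> X.scc_of x" by simp
  qed
  have "X.scc_of ` pverts X = B ` pverts H"
  proof (intro equalityI subsetI)
    fix A assume "A \<in> X.scc_of ` pverts X"
    then show "A \<in> B ` pverts H" using scc by (auto simp: X_def)
  next
    fix A assume "A \<in> B ` pverts H"
    then obtain u where u: "u \<in> pverts H" "A = B u" by blast
    then have "A = X.scc_of (c u)" "c u \<in> pverts X" using scc centre by (auto simp: X_def)
    then show "A \<in> X.scc_of ` pverts X" by blast
  qed
  then have comps: "verts ` components X = B ` pverts H" by (simp add: verts_components[OF X])
  have radius: "radius L \<le> ereal (real d)" if L: "L \<in> components X" for L
  proof -
    note comp = component_structure[OF X L]
    obtain u where u: "u \<in> pverts H" "verts L = B u" using comps L by blast
    have arcs: "parcs G \<inter> B u \<times> B u \<subseteq> arcs L" using u by (auto simp: comp(7) X_def)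
    show ?thesis
    proof (rule radius_le_if_centre[OF comp(1-3)])
      show "c u \<in> verts L" using centre u by simp
      fix x assume "x \<in> verts L"
      then obtain n where "n \<le> d" "(c u, x) \<in> (parcs G \<inter> B u \<times> B u) ^^ n" using near u by blast
      then show "\<exists>n \<le> d. (c u, x) \<in> arcs L ^^ n" using relpow_subset[OF _ arcs] by blast
    qed
  qed
  have inj: "inj_on B (pverts H)"
  proof (rule inj_onI, rule ccontr)
    fix u v assume uv: "u \<in> pverts H" "v \<in> pverts H" "B u = B v" "u \<noteq> v"
    then show False using disj[OF uv(1,2,4)] centre[OF uv(1)] by simp
  qed
  define K where "K = \<lparr>pverts = B ` pverts H, parcs = map_prod B B ` parcs H\<rparr>"
  have K: "pair_graph K"
  proof (rule pair_graphI)
    show "finite (pverts K)" using pair_graphD(1)[OF H] by (simp add: K_def)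
    show "parcs K \<subseteq> pverts K \<times> pverts K" using pair_graphD(2)[OF H] by (force simp: K_def)
    show "sym (parcs K)" using pair_graphD(3)[OF H] by (intro symI) (force simp: K_def dest: symD)
    show "(A, A) \<notin> parcs K" for A
    proof
      assume "(A, A) \<in> parcs K"
      then obtain u v where "(u, v) \<in> parcs H" "B u = B v" by (auto simp: K_def)
      moreover then have "u \<in> pverts H" "v \<in> pverts H" using pair_graphD(2)[OF H] by auto
      ultimately show False using inj_onD[OF inj, of u v] pair_graphD(4)[OF H] by auto
    qed
  qed
  have wf: "pair_wf_digraph (contract_components G X)"
    by unfold_locales (auto simp: contract_components_def Let_def)
  have "is_subgraph K (contract_components G X)"
    unfolding is_subgraph_iff[OF wf]
  proof (intro conjI K)
    show V: "pverts K \<subseteq> pverts (contract_components G X)"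
      by (simp add: K_def contract_components_def Let_def comps)
    show "parcs K \<subseteq> parcs (contract_components G X)"
    proof
      fix e assume "e \<in> parcs K"
      then obtain u v where uv: "(u, v) \<in> parcs H" "e = (B u, B v)" by (auto simp: K_def)
      then have "u \<in> pverts H" "v \<in> pverts H" "u \<noteq> v" using pair_graphD(2,4)[OF H] by auto
      then have "B u \<noteq> B v" "B u \<in> B ` pverts H" "B v \<in> B ` pverts H" using inj_onD[OF inj, of u v] by auto
      then show "e \<in> parcs (contract_components G X)"
        using edges[OF uv(1)] uv(2) by (simp add: contract_components_def Let_def comps)
    qed
  qed
  moreover have "isomorphic H K"
    unfolding isomorphic_iff[OF pair_graphD(6)[OF H]] using inj by (auto simp: K_def)
  then have "isomorphic K H" by (rule isomorphic_sym[OF pair_graphD(6)[OF H]])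
  ultimately show ?thesis unfolding shallow_minor_def using H X_G radius by blast
qed

lemma shallow_minor_refl:
  assumes G: "pair_graph G"
  shows "shallow_minor 0 G G"
  by (rule shallow_minor_if_branch_sets[OF G G, where B = "\<lambda>v. {v}" and c = "\<lambda>v. v"]) auto

lemma relpow_along_vwalk:
  assumes "\<And>a b. (a, b) \<in> set (vwalk_arcs (u # xs)) \<Longrightarrow> (f a, f b) \<in> R" "x \<in> set (u # xs)"
  shows "\<exists>n \<le> length xs. (f u, f x) \<in> R ^^ n"
  using assms
proof (induction xs arbitrary: u)
  case Nil
  then show ?case by simp
next
  case (Cons y ys)
  show ?case
  proof (cases "x = u")
    case True
    then show ?thesis by (intro exI[of _ 0]) simp
  next
    case False
    have "(f a, f b) \<in> R" if "(a, b) \<in> set (vwalk_arcs (y # ys))" for a b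
      using Cons.prems(1) that by simp
    then obtain n where n: "n \<le> length ys" "(f y, f x) \<in> R ^^ n" using Cons.IH[of y] Cons.prems(2) False by auto
    have "(f u, f y) \<in> R" by (rule Cons.prems(1)) simp
    then have "(f u, f x) \<in> R ^^ Suc n" using n(2) by (rule relpow_Suc_I2)
    then show ?thesis using n(1) by (intro exI[of _ "Suc n"]) simp
  qed
qed

lemma last_vwalk_arc: "(last (u # xs), v) \<in> set (vwalk_arcs (u # xs @ [v]))"
  by (induction xs arbitrary: u) auto

lemma vwalk_arcs_butlast_subset: "set (vwalk_arcs (u # xs)) \<subseteq> set (vwalk_arcs (u # xs @ [v]))"
  by (induction xs arbitrary: u) auto

text \<open>
  The branch set of \<open>u\<close> consists of \<open>u\<close> and the interiors of the paths towards larger neighbours.  Such an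
  interior has up to \<open>2 * r\<close> vertices, which is the depth; the last arc of the path leads to the branch
  set of the larger end.
\<close>

lemma shallow_minor_if_shallow_topological_minor:
  fixes G G' :: "'a pair_pre_digraph" and H :: "nat pair_pre_digraph"
  assumes G: "pair_graph G" and sub: "is_subgraph G' G" and minor: "shallow_topological_minor r H G'"
  shows "shallow_minor (2 * r) H G"
proof -
  obtain P S K where H: "pair_graph H" and P: "subdividing_paths (2 * r) H P" and S: "S = subdivide_along H P"
    and K: "is_subgraph K G'" and iso: "isomorphic S K"
    using minor unfolding shallow_topological_minor_def le_subdivision_def by blast
  have P': "P (v, u) = rev (P (u, v))" "length (P (u, v)) \<le> 2 * r" "set (P (u, v)) \<inter> pverts H = {}"
    if "(u, v) \<in> parcs H" for u v using P that unfolding subdividing_paths_def by auto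
  have P_disj: "set (P (x, y)) \<inter> set (P (u, v)) = {}"
    if "(u, v) \<in> parcs H" "(x, y) \<in> parcs H" "{x, y} \<noteq> {u, v}" for u v x y
    using P that unfolding subdividing_paths_def by fast
  have K_G: "pverts K \<subseteq> pverts G" "parcs K \<subseteq> parcs G"
    using K sub by (auto simp: is_subgraph_def subgraph_def)
  have "wf_digraph (with_proj S)"
    using iso by (auto simp: isomorphic_def digraph_iso_def pre_digraph.digraph_isomorphism_def)
  then have wfS: "pair_wf_digraph S" by (simp add: wf_digraph_wp_iff)
  from iso[unfolded isomorphic_iff[OF wfS]]
  obtain \<phi> where \<phi>: "inj_on \<phi> (pverts S)" "pverts K = \<phi> ` pverts S" "parcs K = map_prod \<phi> \<phi> ` parcs S"
    by blast
  have arc_G: "(\<phi> a, \<phi> b) \<in> parcs G" if "(a, b) \<in> parcs S" for a b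
    using that \<phi>(3) K_G(2) by force
  have arc_S: "(a, b) \<in> parcs S" if "(u, v) \<in> parcs H" "(a, b) \<in> set (vwalk_arcs (u # P (u, v) @ [v]))" for a b u v
    using that unfolding S subdivide_along_def by auto
  define U where "U u = insert u (\<Union>v \<in> {v. (u, v) \<in> parcs H \<and> u < v}. set (P (u, v)))" for u
  have U_S: "U u \<subseteq> pverts S" if "u \<in> pverts H" for u
    using that by (auto simp: U_def S subdivide_along_def)
  have U_disj: "U u \<inter> U v = {}" if uv: "u \<in> pverts H" "v \<in> pverts H" "u \<noteq> v" for u v
  proof -
    have "set (P (u, x)) \<inter> set (P (v, y)) = {}"
      if "(u, x) \<in> parcs H" "u < x" "(v, y) \<in> parcs H" "v < y" for x y
      using that uv(3) by (intro P_disj) (auto simp: doubleton_eq_iff)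
    moreover have "w \<notin> set (P (u, x))" if "(u, x) \<in> parcs H" "w \<in> pverts H" for u w x
      using P'(3)[OF that(1)] that(2) by blast
    ultimately show ?thesis using uv unfolding U_def by blast
  qed
  show ?thesis
  proof (rule shallow_minor_if_branch_sets[OF G H, where B = "\<lambda>u. \<phi> ` U u" and c = \<phi>])
    show "\<phi> ` U u \<subseteq> pverts G" if "u \<in> pverts H" for u
      using U_S[OF that] \<phi>(2) K_G(1) by blast
    show "\<phi> u \<in> \<phi> ` U u" for u by (simp add: U_def)
    show "\<phi> ` U u \<inter> \<phi> ` U v = {}" if "u \<in> pverts H" "v \<in> pverts H" "u \<noteq> v" for u v
      using inj_on_image_Int[OF \<phi>(1) U_S U_S, of u v] U_disj[OF that] that by simp
  next
    fix u x assume u: "u \<in> pverts H" and x: "x \<in> \<phi> ` U u"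
    then obtain y where y: "y \<in> U u" "x = \<phi> y" by blast
    let ?R = "parcs G \<inter> \<phi> ` U u \<times> \<phi> ` U u"
    show "\<exists>n \<le> 2 * r. (\<phi> u, x) \<in> ?R ^^ n"
    proof (cases "y = u")
      case True
      then show ?thesis using y(2) by (intro exI[of _ 0]) simp
    next
      case False
      then obtain v where v: "(u, v) \<in> parcs H" "u < v" "y \<in> set (P (u, v))" using y(1) by (auto simp: U_def)
      have "(\<phi> a, \<phi> b) \<in> ?R" if "(a, b) \<in> set (vwalk_arcs (u # P (u, v)))" for a b
      proof -
        have "(a, b) \<in> parcs S" by (rule arc_S[OF v(1) subsetD[OF vwalk_arcs_butlast_subset that]])
        moreover have "set (u # P (u, v)) \<subseteq> U u" using v by (auto simp: U_def)
        then have "a \<in> U u" "b \<in> U u" using arcs_in_vwalk_arcs[OF that] by auto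
        ultimately show ?thesis using arc_G by blast
      qed
      then obtain n where "n \<le> length (P (u, v))" "(\<phi> u, \<phi> y) \<in> ?R ^^ n"
        using relpow_along_vwalk[of u "P (u, v)" \<phi> ?R y] v(3) by auto
      then show ?thesis using P'(2)[OF v(1)] y(2) le_trans by blast
    qed
  next
    have half: "\<exists>a \<in> U u. (\<phi> a, \<phi> v) \<in> parcs G" if "(u, v) \<in> parcs H" "u < v" for u v
    proof -
      have "(last (u # P (u, v)), v) \<in> parcs S" by (rule arc_S[OF that(1) last_vwalk_arc])
      moreover have "last (u # P (u, v)) \<in> set (u # P (u, v))" by (rule last_in_set) simp
      then have "last (u # P (u, v)) \<in> U u" using that by (auto simp: U_def)
      ultimately show ?thesis using arc_G by blast
    qed
    fix u v assume uv: "(u, v) \<in> parcs H"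
    then have "(v, u) \<in> parcs H" "u \<noteq> v" using pair_graphD(3,4)[OF H] by (auto dest: symD)
    have self: "w \<in> U w" for w by (simp add: U_def)
    show "\<exists>a \<in> \<phi> ` U u. \<exists>b \<in> \<phi> ` U v. (a, b) \<in> parcs G"
    proof (cases "u < v")
      case True
      then show ?thesis using half[OF uv] self by blast
    next
      case False
      then obtain a where "a \<in> U v" "(\<phi> a, \<phi> u) \<in> parcs G"
        using half[OF \<open>(v, u) \<in> parcs H\<close>] \<open>u \<noteq> v\<close> by auto
      then show ?thesis using self pair_graphD(3)[OF G] by (blast dest: symD)
    qed
  qed
qed

lemma top_nabla_le_nabla:
  assumes "G \<in> \<C>" "pair_graph G" "is_subgraph H G"
  shows "top_nabla r H \<le> nabla (2 * r) \<C>"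
  unfolding top_nabla_def nabla_def
proof (rule Sup_subset_mono, clarify)
  fix H' :: "nat pair_pre_digraph"
  assume H': "pverts H' \<noteq> {}" "shallow_topological_minor r H' H"
  have minor: "shallow_minor (2 * r) H' G"
    by (rule shallow_minor_if_shallow_topological_minor[OF assms(2,3) H'(2)])
  show "\<exists>H'' :: nat pair_pre_digraph. ereal (density H') = ereal (density H'') \<and> pverts H'' \<noteq> {} \<and>
      (\<exists>G \<in> \<C>. shallow_minor (2 * r) H'' G)"
    by (intro exI[of _ H'] conjI bexI[of _ G] refl H'(1) assms(1) minor)
qed

lemma num_edges_le_nabla:
  assumes "G \<in> \<C>" "pair_graph G" "nabla 0 \<C> \<le> ereal c"
  shows "real (num_edges G) \<le> max c 0 * real (num_verts G)"
proof (cases "pverts G = {}")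
  case True
  then have "parcs G = {}" using pair_graphD(2)[OF assms(2)] by auto
  then show ?thesis by (simp add: num_edges_def)
next
  case False
  then have n: "0 < real (num_verts G)" using pair_graphD(1)[OF assms(2)] by (simp add: num_verts_def card_gt_0_iff)
  have "ereal (density G) \<le> nabla 0 \<C>"
    unfolding nabla_def
    by (rule Sup_upper, rule CollectI)
      (intro exI[of _ G] conjI bexI[of _ G] refl False assms(1) shallow_minor_refl[OF assms(2)])
  then have "density G \<le> c" using order_trans[OF _ assms(3)] by (simp flip: ereal_less_eq(3))
  then have "real (num_edges G) / real (num_verts G) \<le> max c 0" by (simp add: density_def)
  then show ?thesis using n by (simp add: pos_divide_le_eq)
qed

text \<open>
  Markov's inequality: the average degree is at most \<open>2 * c\<close>.  The summand \<open>1\<close> keeps the threshold positive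
  when \<open>c = 0\<close>.
\<close>

lemma high_degree_fraction_le:
  assumes G: "pair_graph G" and edges: "real (num_edges G) \<le> c * real (num_verts G)" and c: "0 \<le> c" and \<epsilon>: "0 < \<epsilon>"
  shows "real (card {v \<in> pverts G. 2 * c / \<epsilon> + 1 \<le> real (degree G v)}) / real (num_verts G) \<le> \<epsilon>"
proof -
  define A where "A = {v \<in> pverts G. 2 * c / \<epsilon> + 1 \<le> real (degree G v)}"
  define q where "q = 2 * c / \<epsilon> + 1"
  have q: "0 < q" "2 * c \<le> q * \<epsilon>" using c \<epsilon> by (simp_all add: q_def add_nonneg_pos field_simps)
  have "real (card A) * q = (\<Sum>v \<in> A. q)" by simp
  also have "\<dots> \<le> (\<Sum>v \<in> A. real (degree G v))" by (rule sum_mono) (simp add: A_def q_def)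
  also have "\<dots> \<le> (\<Sum>v \<in> pverts G. real (degree G v))"
    by (rule sum_mono2[OF pair_graphD(1)[OF G]]) (auto simp: A_def)
  also have "\<dots> \<le> 2 * real (num_edges G)" using of_nat_mono[OF sum_degree_le[OF G], where ?'a = real] by simp
  also have "\<dots> \<le> (2 * c) * real (num_verts G)" using edges by simp
  also have "\<dots> \<le> (q * \<epsilon>) * real (num_verts G)" by (rule mult_right_mono[OF q(2)]) simp
  finally have "q * real (card A) \<le> q * (\<epsilon> * real (num_verts G))" by (simp add: mult_ac)
  then have "real (card A) \<le> \<epsilon> * real (num_verts G)" using q(1) by simp
  then have "real (card A) / real (num_verts G) \<le> \<epsilon>"
    using \<epsilon> by (cases "num_verts G = 0") (simp_all add: field_simps)
  then show ?thesis by (simp add: A_def)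
qed

section \<open>Dense topological minors inside a graph\<close>

text \<open>
  A walk is turned into a path by dropping the loop whenever its first vertex is met again.
\<close>

lemma linked_path:
  assumes "linked E I u v"
  shows "\<exists>xs. distinct xs \<and> set xs \<subseteq> I \<and> set (vwalk_arcs (u # xs @ [v])) \<subseteq> E"
  using assms
proof (induction rule: linked.induct)
  case (edge u v)
  then show ?case by (intro exI[of _ "[]"]) simp
next
  case (step u w v)
  then obtain xs where xs: "distinct xs" "set xs \<subseteq> I" "set (vwalk_arcs (w # xs @ [v])) \<subseteq> E" by blast
  show ?case
  proof (cases "w \<in> set xs")
    case False
    then show ?thesis using xs step.hyps by (intro exI[of _ "w # xs"]) simp
  next
    case True
    then obtain ys zs where [simp]: "xs = ys @ w # zs" by (auto dest: split_list)
    have "set (vwalk_arcs (w # zs @ [v])) \<subseteq> set (vwalk_arcs ((w # ys) @ (w # zs @ [v])))"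
      by (rule subsetI, rule in_set_vwalk_arcs_append1) simp
    then have "set (vwalk_arcs (u # (w # zs) @ [v])) \<subseteq> E"
      using xs(3) step.hyps(1) by auto
    then show ?thesis using xs(1,2) by (intro exI[of _ "w # zs"]) simp
  qed
qed

lemma set_subset_vwalk_arcs: "set xs \<subseteq> snd ` set (vwalk_arcs (u # xs @ [v]))"
  by (induction xs arbitrary: u) auto

text \<open>
  The subdivision lies in \<open>G\<close> literally: the vertices of the minor and of its subdivision are vertices
  of \<open>G\<close>, and the only choice is that of a path inside each interior.
\<close>

lemma topological_model_as_subgraph:
  fixes G :: "nat pair_pre_digraph"
  assumes G: "pair_graph G" and model: "topological_model (parcs G) (2 * r) Z M I"
    and Z: "Z \<subseteq> pverts G" "Z \<noteq> {}"
  obtains S where "is_subgraph S G" "num_verts S \<le> card Z + 2 * r * card M"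
    "ereal (real (card M) / real (card Z)) \<le> top_nabla r S"
proof -
  note finZ = topological_modelD(1)[OF model] and finM = topological_modelD(2)[OF model]
    and MZ = topological_modelD(3)[OF model] and asym = topological_modelD(4)[OF model]
    and path = topological_model_pathD[OF model] and disj = topological_model_disjointD[OF model]
  have "\<forall>e \<in> M. \<exists>xs. distinct xs \<and> set xs \<subseteq> I e \<and> set (vwalk_arcs (fst e # xs @ [snd e])) \<subseteq> parcs G"
    by (intro ballI linked_path path(4))
  from bchoice[OF this] obtain Q where
    "\<forall>e \<in> M. distinct (Q e) \<and> set (Q e) \<subseteq> I e \<and> set (vwalk_arcs (fst e # Q e @ [snd e])) \<subseteq> parcs G" ..
  then have Q: "distinct (Q e)" "set (Q e) \<subseteq> I e"
      and Q_arcs: "set (vwalk_arcs (fst e # Q e @ [snd e])) \<subseteq> parcs G" if "e \<in> M" for e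
    using that by simp_all
  define P where "P e = (if e \<in> M then Q e else rev (Q (prod.swap e)))" for e
  \<comment> \<open>The arc of \<open>M\<close> that underlies an arc of the symmetric graph \<open>H\<close>.\<close>
  define can where "can e = (if e \<in> M then e else prod.swap e)" for e
  define H where "H = \<lparr>pverts = Z, parcs = M \<union> prod.swap ` M\<rparr>"
  have no_loop: "(v, v) \<notin> M" for v using asym by (auto simp: asym_iff)
  have arcs_H: "(u, v) \<in> parcs H \<longleftrightarrow> (u, v) \<in> M \<or> (v, u) \<in> M" for u v
    by (auto simp: H_def intro: rev_image_eqI)
  have H: "pair_graph H"
  proof (rule pair_graphI)
    show "parcs H \<subseteq> pverts H \<times> pverts H" using MZ by (auto simp: H_def)
    show "sym (parcs H)" by (rule symI) (auto simp: arcs_H)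
    show "(v, v) \<notin> parcs H" for v using no_loop by (simp add: arcs_H)
  qed (simp add: H_def finZ)
  have can: "can (u, v) \<in> M" "{fst (can (u, v)), snd (can (u, v))} = {u, v}" "set (P (u, v)) \<subseteq> I (can (u, v))"
      "distinct (P (u, v))" "P (v, u) = rev (P (u, v))"
      "set (vwalk_arcs (u # P (u, v) @ [v])) \<subseteq> parcs G" if "(u, v) \<in> parcs H" for u v
  proof -
    have "(u, v) \<in> M \<and> (v, u) \<notin> M \<or> (v, u) \<in> M \<and> (u, v) \<notin> M"
      using that asym by (auto simp: arcs_H asym_iff)
    then show "can (u, v) \<in> M" "{fst (can (u, v)), snd (can (u, v))} = {u, v}" "set (P (u, v)) \<subseteq> I (can (u, v))"
      "distinct (P (u, v))" "P (v, u) = rev (P (u, v))"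
      using Q[of "(u, v)"] Q[of "(v, u)"] by (auto simp: can_def P_def)
    show "set (vwalk_arcs (u # P (u, v) @ [v])) \<subseteq> parcs G"
    proof (cases "(u, v) \<in> M")
      case True
      then show ?thesis using Q_arcs[of "(u, v)"] by (simp add: P_def)
    next
      case False
      then have "(v, u) \<in> M" using that by (simp add: arcs_H)
      then have "set (vwalk_arcs (v # Q (v, u) @ [u])) \<subseteq> parcs G" using Q_arcs[of "(v, u)"] by simp
      moreover have "u # P (u, v) @ [v] = rev (v # Q (v, u) @ [u])" using False by (simp add: P_def)
      ultimately show ?thesis
        using pair_graphD(3)[OF G] by (simp only: set_vwalk_arcs_rev) (auto dest: symD)
    qed
  qed
  have paths: "subdividing_paths (2 * r) H P"
    unfolding subdividing_paths_def
  proof (intro ballI, clarify)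
    fix u v assume uv: "(u, v) \<in> parcs H"
    note c = can[OF uv]
    have "length (P (u, v)) = card (set (P (u, v)))" using distinct_card[OF c(4)] by simp
    also have "\<dots> \<le> card (I (can (u, v)))" by (rule card_mono[OF path(1)[OF c(1)] c(3)])
    finally have "length (P (u, v)) \<le> 2 * r" using path(2)[OF c(1)] by simp
    moreover have "set (P (u, v)) \<inter> pverts H = {}" using c(3) path(3)[OF c(1)] by (auto simp: H_def)
    moreover have "set (P (x, y)) \<inter> set (P (u, v)) = {}" if xy: "(x, y) \<in> parcs H" "{x, y} \<noteq> {u, v}" for x y
    proof -
      note c' = can[OF xy(1)]
      have "can (x, y) \<noteq> can (u, v)" using c(2) c'(2) xy(2) by metis
      then show ?thesis using disj[OF c'(1) c(1)] c(3) c'(3) by blast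
    qed
    ultimately show "P (v, u) = rev (P (u, v)) \<and> length (P (u, v)) \<le> 2 * r \<and> distinct (P (u, v)) \<and>
        set (P (u, v)) \<inter> pverts H = {} \<and>
        (\<forall>(x, y) \<in> parcs H. {x, y} \<noteq> {u, v} \<longrightarrow> set (P (x, y)) \<inter> set (P (u, v)) = {})"
      using c(4,5) by blast
  qed
  define S where "S = subdivide_along H P"
  have verts_S: "pverts S = Z \<union> (\<Union>e \<in> parcs H. set (P e))" by (simp add: S_def subdivide_along_def H_def)
  have arcs_S: "parcs S = (\<Union>(u, v) \<in> parcs H. set (vwalk_arcs (u # P (u, v) @ [v])))"
    by (simp add: S_def subdivide_along_def)
  have verts_S': "pverts S = Z \<union> (\<Union>e \<in> M. set (Q e))"
  proof -
    have "(\<Union>e \<in> parcs H. set (P e)) = (\<Union>e \<in> M. set (Q e))"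
    proof (intro equalityI subsetI)
      fix x assume "x \<in> (\<Union>e \<in> parcs H. set (P e))"
      then obtain u v where "(u, v) \<in> parcs H" "x \<in> set (P (u, v))" by auto
      then show "x \<in> (\<Union>e \<in> M. set (Q e))" by (auto simp: P_def arcs_H split: if_splits)
    next
      fix x assume "x \<in> (\<Union>e \<in> M. set (Q e))"
      then show "x \<in> (\<Union>e \<in> parcs H. set (P e))" by (auto simp: P_def H_def)
    qed
    then show ?thesis using verts_S by simp
  qed
  have S_G: "parcs S \<subseteq> parcs G" using can(6) unfolding arcs_S by blast
  have S: "is_subgraph S G"
    unfolding is_subgraph_iff[OF pair_graphD(6)[OF G]]
  proof (intro conjI pair_graphI S_G)
    show "finite (pverts S)" using finZ finM by (simp add: verts_S')
    show "parcs S \<subseteq> pverts S \<times> pverts S"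
    proof
      fix e assume "e \<in> parcs S"
      then obtain u v where uv: "(u, v) \<in> parcs H" "e \<in> set (vwalk_arcs (u # P (u, v) @ [v]))"
        by (auto simp: arcs_S)
      then have "e \<in> set (u # P (u, v) @ [v]) \<times> set (u # P (u, v) @ [v])"
        by (intro arcs_in_vwalk_arcs)
      moreover have "u \<in> Z" "v \<in> Z" using uv(1) MZ by (auto simp: arcs_H)
      ultimately show "e \<in> pverts S \<times> pverts S" using uv(1) by (auto simp: verts_S)
    qed
    show "sym (parcs S)"
    proof (rule symI)
      fix a b assume "(a, b) \<in> parcs S"
      then obtain u v where uv: "(u, v) \<in> parcs H" "(a, b) \<in> set (vwalk_arcs (u # P (u, v) @ [v]))"
        by (auto simp: arcs_S)
      have "v # P (v, u) @ [u] = rev (u # P (u, v) @ [v])" using can(5)[OF uv(1)] by simp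
      then have "(b, a) \<in> set (vwalk_arcs (v # P (v, u) @ [u]))" using uv(2) by (simp only: set_vwalk_arcs_rev) simp
      moreover have "(v, u) \<in> parcs H" using uv(1) by (auto simp: arcs_H)
      ultimately show "(b, a) \<in> parcs S" unfolding arcs_S by blast
    qed
    show "(v, v) \<notin> parcs S" for v using S_G pair_graphD(4)[OF G] by blast
    have "set (P (u, v)) \<subseteq> pverts G" if "(u, v) \<in> parcs H" for u v
    proof -
      have "snd ` set (vwalk_arcs (u # P (u, v) @ [v])) \<subseteq> snd ` parcs G"
        by (rule image_mono[OF can(6)[OF that]])
      also have "\<dots> \<subseteq> pverts G" using pair_graphD(2)[OF G] by auto
      finally show ?thesis using set_subset_vwalk_arcs[of "P (u, v)" u v] by blast
    qed
    then show "pverts S \<subseteq> pverts G" using Z(1) by (auto simp: verts_S)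
  qed
  moreover have "num_verts S \<le> card Z + 2 * r * card M"
  proof -
    have "card (\<Union>e \<in> M. set (Q e)) \<le> (\<Sum>e \<in> M. card (set (Q e)))" by (rule card_UN_le[OF finM])
    also have "\<dots> \<le> (\<Sum>e \<in> M. 2 * r)"
    proof (rule sum_mono)
      fix e assume e: "e \<in> M"
      then have "card (set (Q e)) \<le> card (I e)" by (intro card_mono path(1) Q(2))
      then show "card (set (Q e)) \<le> 2 * r" using path(2)[OF e] by simp
    qed
    finally show ?thesis
      using card_Un_le[of Z "\<Union>e \<in> M. set (Q e)"] by (simp add: num_verts_def verts_S' mult.commute)
  qed
  moreover have "ereal (real (card M) / real (card Z)) \<le> top_nabla r S"
  proof -
    have wfS: "pair_graph S" using S pair_graphD(6)[OF G] by (simp add: is_subgraph_iff)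
    have "{{u, v} | u v. (u, v) \<in> parcs H} = (\<lambda>e. {fst e, snd e}) ` M"
    proof (intro equalityI subsetI)
      fix B assume "B \<in> {{u, v} | u v. (u, v) \<in> parcs H}"
      then obtain u v where "B = {u, v}" "(u, v) \<in> M \<or> (v, u) \<in> M" by (auto simp: arcs_H)
      then show "B \<in> (\<lambda>e. {fst e, snd e}) ` M"
        by (auto intro: rev_image_eqI[of "(u, v)"] rev_image_eqI[of "(v, u)"])
    next
      fix B assume "B \<in> (\<lambda>e. {fst e, snd e}) ` M"
      then obtain u v where "(u, v) \<in> M" "B = {u, v}" by auto
      then show "B \<in> {{u, v} | u v. (u, v) \<in> parcs H}" by (auto simp: arcs_H)
    qed
    then have "num_edges H = card M"
      unfolding num_edges_def using inj_on_edge_set[OF asym] by (simp add: card_image)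
    then have "density H = real (card M) / real (card Z)" by (simp add: density_def num_verts_def H_def)
    moreover have "shallow_topological_minor r H S"
      unfolding shallow_topological_minor_def le_subdivision_def
    proof (intro conjI exI)
      show "subdividing_paths (2 * r) H P" "pair_graph H" by fact+
      show "S = subdivide_along H P" by (rule S_def)
      show "is_subgraph S S" using wfS pair_graphD(6)[OF wfS] by (simp add: is_subgraph_iff)
      show "isomorphic S S" by (rule isomorphic_refl[OF pair_graphD(6)[OF wfS]])
    qed
    moreover have "pverts H \<noteq> {}" using Z(2) by (simp add: H_def)
    ultimately show ?thesis unfolding top_nabla_def
      by (intro Sup_upper) (auto intro!: exI[of _ H])
  qed
  ultimately show ?thesis using that by blast
qed

text \<open>
  The set \<open>B\<close> collects the vertices of high degree.  Edges of a model with an end \<open>z\<close> outside \<open>B\<close> inject into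
  the neighbours of \<open>z\<close> by their first step.  Edges inside \<open>B\<close> cannot be dense: \<open>c * card (Z \<inter> B)\<close> of them
  would give a subgraph with at most \<open>card B * (1 + 2 * r * c)\<close> vertices that has a topological minor of
  density \<open>c\<close>.
\<close>

lemma sparse_if_dense_parts_large:
  fixes G :: "nat pair_pre_digraph" and D c r :: nat
  defines "B \<equiv> {v \<in> pverts G. D \<le> degree G v}"
  assumes G: "pair_graph G"
    and few: "real (card B) * (1 + 2 * r * c) \<le> b"
    and large: "\<And>S. is_subgraph S G \<Longrightarrow> real (num_verts S) \<le> b \<Longrightarrow> top_nabla r S < ereal (real c)"
  shows "sparse (parcs G) (2 * r) (D + c)"
proof (rule sparseI)
  fix Z M I
  assume model: "topological_model (parcs G) (2 * r) Z M I" and "Z \<subseteq> fst ` parcs G \<union> snd ` parcs G"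
  moreover have "fst ` parcs G \<union> snd ` parcs G \<subseteq> pverts G" using pair_graphD(2)[OF G] by auto
  ultimately have ZG: "Z \<subseteq> pverts G" by blast
  note finZ = topological_modelD(1)[OF model] and finM = topological_modelD(2)[OF model]
    and MZ = topological_modelD(3)[OF model] and asym = topological_modelD(4)[OF model]
    and path = topological_model_pathD(3,4)[OF model] and disj = topological_model_disjointD[OF model]
  define high_M where "high_M = {e \<in> M. fst e \<in> B \<and> snd e \<in> B}"
  define low_M where "low_M = M - high_M"
  \<comment> \<open>Every edge not inside \<open>B\<close> has an end of low degree, at which it is counted.\<close>
  define low where "low e = (if fst e \<in> B then snd e else fst e)" for e
  define other where "other e = (if fst e \<in> B then fst e else snd e)" for e
  have finB: "finite B" using pair_graphD(1)[OF G] by (simp add: B_def)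
  have low: "low e \<in> Z" "low e \<notin> B" "other e \<in> Z" "{low e, other e} = {fst e, snd e}"
      "\<exists>w \<in> insert (other e) (I e). (low e, w) \<in> parcs G" if "e \<in> low_M" for e
  proof -
    have e: "e \<in> M" "fst e \<in> Z" "snd e \<in> Z" using that MZ by (auto simp: low_M_def)
    then show "low e \<in> Z" "low e \<notin> B" "other e \<in> Z" "{low e, other e} = {fst e, snd e}"
      using that by (auto simp: low_def other_def low_M_def high_M_def)
    have "linked (parcs G) (I e) (low e) (other e)"
      using path(2)[OF e(1)] linked_sym[OF path(2)[OF e(1)] pair_graphD(3)[OF G]]
      by (simp add: low_def other_def)
    then show "\<exists>w \<in> insert (other e) (I e). (low e, w) \<in> parcs G" by (rule linked_first_step)
  qed
  have "card {e \<in> low_M. low e = z} \<le> D" if z: "z \<in> low ` low_M" for z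
  proof -
    have "\<forall>e \<in> {e \<in> low_M. low e = z}. \<exists>w. w \<in> insert (other e) (I e) \<and> (z, w) \<in> parcs G"
    proof (rule ballI)
      fix e assume "e \<in> {e \<in> low_M. low e = z}"
      then have "e \<in> low_M" "low e = z" by simp_all
      then show "\<exists>w. w \<in> insert (other e) (I e) \<and> (z, w) \<in> parcs G" using low(5)[of e] by blast
    qed
    from bchoice[OF this] obtain w where
      w: "\<forall>e \<in> {e \<in> low_M. low e = z}. w e \<in> insert (other e) (I e) \<and> (z, w e) \<in> parcs G" ..
    have "inj_on w {e \<in> low_M. low e = z}"
    proof (rule inj_onI, rule ccontr)
      fix e f assume ef: "e \<in> {e \<in> low_M. low e = z}" "f \<in> {e \<in> low_M. low e = z}" "w e = w f" "e \<noteq> f"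
      then have M: "e \<in> M" "f \<in> M" "e \<in> low_M" "f \<in> low_M" by (auto simp: low_M_def)
      have "w e \<in> insert (other e) (I e)" "w e \<in> insert (other f) (I f)"
        using bspec[OF w ef(1)] bspec[OF w ef(2)] ef(3) by simp_all
      \<comment> \<open>The interiors are disjoint from each other and from \<open>Z\<close>, so a common first step is the other end of both edges.\<close>
      then have "other e = other f"
        using disj[OF M(1,2) ef(4)] path(1)[OF M(1)] path(1)[OF M(2)] low(3)[OF M(3)] low(3)[OF M(4)] by auto
      then have "{fst e, snd e} = {fst f, snd f}"
        using low(4)[OF M(3)] low(4)[OF M(4)] ef(1,2) by auto
      then show False using inj_onD[OF inj_on_edge_set[OF asym]] M ef(4) by blast
    qed
    then have "card {e \<in> low_M. low e = z} \<le> card {w. (z, w) \<in> parcs G}"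
    proof (rule card_inj_on_le)
      show "finite {w. (z, w) \<in> parcs G}"
        using finite_imageI[OF pair_graphD(5)[OF G], of snd] by (rule finite_subset[rotated]) force
    qed (use w in auto)
    also have "\<dots> \<le> D"
    proof -
      obtain e where "e \<in> low_M" "z = low e" using z by blast
      then have "z \<in> pverts G" "z \<notin> B" using low(1,2)[of e] ZG by auto
      then show ?thesis by (simp add: B_def degree_eq)
    qed
    finally show ?thesis .
  qed
  then have "card low_M \<le> D * card (low ` low_M)"
    using finM by (intro card_le_fibres) (auto simp: low_M_def)
  also have "card (low ` low_M) \<le> card Z" using low(1) by (intro card_mono[OF finZ]) auto
  finally have low_M: "card low_M \<le> D * card Z" by simp

  have high_M: "card high_M \<le> c * card (Z \<inter> B)"
  proof (rule ccontr)
    assume not: "\<not> ?thesis"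
    then obtain M' where M': "M' \<subseteq> high_M" "card M' = c * card (Z \<inter> B)"
      using obtain_subset_with_card_n[of "c * card (Z \<inter> B)" high_M] by auto
    have "high_M \<subseteq> (Z \<inter> B) \<times> (Z \<inter> B)" using MZ by (force simp: high_M_def)
    moreover have "high_M \<noteq> {}" using not by auto
    ultimately have ne: "Z \<inter> B \<noteq> {}" and M'Z: "M' \<subseteq> (Z \<inter> B) \<times> (Z \<inter> B)" using M'(1) by auto
    have "M' \<subseteq> M" using M'(1) by (auto simp: high_M_def)
    have "topological_model (parcs G) (2 * r) (Z \<inter> B) M' I"
      by (rule topological_model_restrict[OF model \<open>M' \<subseteq> M\<close> _ M'Z]) simp
    then obtain S where S: "is_subgraph S G" "num_verts S \<le> card (Z \<inter> B) + 2 * r * card M'"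
        "ereal (real (card M') / real (card (Z \<inter> B))) \<le> top_nabla r S"
      using topological_model_as_subgraph[OF G _ _ ne] ZG by blast
    have "num_verts S \<le> card (Z \<inter> B) * (1 + 2 * r * c)" using S(2) M'(2) by (simp add: algebra_simps)
    also have "\<dots> \<le> card B * (1 + 2 * r * c)" by (intro mult_le_mono1 card_mono finB) simp
    finally have "real (num_verts S) \<le> real (card B * (1 + 2 * r * c))" by (rule of_nat_mono)
    then have "real (num_verts S) \<le> b" using few by (simp add: algebra_simps)
    then have "top_nabla r S < ereal (real c)" by (rule large[OF S(1)])
    moreover have "real (card M') / real (card (Z \<inter> B)) = real c" using M'(2) ne finZ by simp
    ultimately show False using S(3) by (simp add: not_less[symmetric])
  qed
  have "card (Z \<inter> B) \<le> card Z" by (rule card_mono[OF finZ]) simp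
  then have "card high_M \<le> c * card Z" using high_M by (meson le_trans mult_le_mono2)
  moreover have "card M = card high_M + card low_M"
    using finM by (subst card_Un_disjoint[symmetric]) (auto simp: low_M_def high_M_def intro: arg_cong[where f = card])
  ultimately show "card M \<le> (D + c) * card Z" using low_M by (simp add: algebra_simps)
qed

section \<open>The characterisation\<close>

theorem lemma3p5:
  fixes \<C> :: "nat pair_pre_digraph set"
  assumes "\<And>G. G \<in> \<C> \<Longrightarrow> pair_graph G"
  shows "bounded_expansion \<C> \<longleftrightarrow>
    (\<exists>F_ord F_deg F_nabla F_prop :: real \<Rightarrow> real.
      (\<forall>x. F_prop x > 0) \<and>
      (\<forall>\<epsilon>>0. \<forall>G\<in>\<C>. real (num_verts G) > F_ord \<epsilon> \<longrightarrow>
        real (card {v \<in> pverts G. real (degree G v) \<ge> F_deg \<epsilon>}) / real (num_verts G) \<le> \<epsilon>) \<and>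
      (\<forall>r::nat. \<forall>G\<in>\<C>. \<forall>H. is_subgraph H G \<longrightarrow>
        top_nabla r H > ereal (F_nabla (real r)) \<longrightarrow>
        real (num_verts H) > F_prop (real r) * real (num_verts G)))"
  (is "_ \<longleftrightarrow> (\<exists>F_ord F_deg F_nabla F_prop. ?pos F_prop \<and> ?deg F_ord F_deg \<and> ?prop F_nabla F_prop)")
proof
  assume "bounded_expansion \<C>"
  then obtain f where f: "\<And>d. nabla d \<C> \<le> ereal (f d)" unfolding bounded_expansion_def by blast
  define c where "c = max (f 0) 0"
  have "?deg (\<lambda>_. 0) (\<lambda>\<epsilon>. 2 * c / \<epsilon> + 1)"
  proof (intro allI impI ballI)
    fix \<epsilon> :: real and G assume "0 < \<epsilon>" "G \<in> \<C>"
    then show "real (card {v \<in> pverts G. 2 * c / \<epsilon> + 1 \<le> real (degree G v)}) / real (num_verts G) \<le> \<epsilon>"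
      using num_edges_le_nabla[OF _ _ f] assms
      by (intro high_degree_fraction_le) (auto simp: c_def)
  qed
  \<comment> \<open>No subgraph satisfies the premise, so the proportion \<open>1\<close> is as good as any.\<close>
  moreover have "?prop (\<lambda>x. f (2 * nat \<lfloor>x\<rfloor>)) (\<lambda>_. 1)"
  proof (intro allI impI ballI)
    fix r G H assume GH: "G \<in> \<C>" "is_subgraph H G" "ereal (f (2 * nat \<lfloor>real r\<rfloor>)) < top_nabla r H"
    have "top_nabla r H \<le> ereal (f (2 * r))"
      using top_nabla_le_nabla[OF GH(1) assms GH(2)] f GH(1) order_trans by blast
    then show "1 * real (num_verts G) < real (num_verts H)" using GH(3) by simp
  qed
  moreover have "?pos (\<lambda>_. 1)" by simp
  ultimately show "\<exists>F_ord F_deg F_nabla F_prop. ?pos F_prop \<and> ?deg F_ord F_deg \<and> ?prop F_nabla F_prop"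
    by (intro exI conjI)
next
  assume "\<exists>F_ord F_deg F_nabla F_prop. ?pos F_prop \<and> ?deg F_ord F_deg \<and> ?prop F_nabla F_prop"
  then obtain F_ord F_deg F_nabla F_prop where
    pos: "?pos F_prop" and deg: "?deg F_ord F_deg" and dense_large: "?prop F_nabla F_prop" by blast
  \<comment> \<open>The number \<open>c r\<close> exceeds the density that forces large subgraphs, and \<open>\<epsilon> r\<close> is so small that
    \<open>1 + 2 * r * c r\<close> vertices for each vertex of high degree make up at most the proportion
    \<open>F_prop r\<close> of the graph.\<close>
  define c where "c r = nat \<lceil>max (F_nabla (real r)) 0\<rceil> + 1" for r :: nat
  define \<epsilon> where "\<epsilon> r = F_prop (real r) / (1 + 2 * real r * real (c r))" for r
  define D where "D r = nat \<lceil>F_deg (\<epsilon> r)\<rceil>" for r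
  define N where "N r = nat \<lceil>F_ord (\<epsilon> r)\<rceil>" for r
  have c: "F_nabla (real r) < real (c r)" for r unfolding c_def by linarith
  have denom: "0 < 1 + 2 * real r * real (c r)" for r by (simp add: add_pos_nonneg)
  have \<epsilon>: "0 < \<epsilon> r" for r using pos denom[of r] by (simp add: \<epsilon>_def)
  have "sparse (parcs G) r (D r + c r + N r)" if G: "G \<in> \<C>" for G r
  proof -
    note graph = assms[OF G]
    have "sparse (parcs G) (2 * r) (D r + c r + N r)"
    proof (cases "F_ord (\<epsilon> r) < real (num_verts G)")
      case True
      define A where "A = {v \<in> pverts G. F_deg (\<epsilon> r) \<le> real (degree G v)}"
      have "finite A" using pair_graphD(1)[OF graph] by (simp add: A_def)
      have "real (card A) / real (num_verts G) \<le> \<epsilon> r" using deg \<epsilon> G True by (simp add: A_def)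
      moreover have "card A = 0" if "num_verts G = 0"
        using that pair_graphD(1)[OF graph] by (simp add: A_def num_verts_def)
      ultimately have A: "real (card A) \<le> \<epsilon> r * real (num_verts G)"
        by (cases "num_verts G = 0") (simp_all add: pos_divide_le_eq)
      have "{v \<in> pverts G. D r \<le> degree G v} \<subseteq> A"
        unfolding A_def D_def by (auto simp: nat_le_iff ceiling_le_iff)
      then have "card {v \<in> pverts G. D r \<le> degree G v} \<le> card A" by (rule card_mono[OF \<open>finite A\<close>])
      then have "real (card {v \<in> pverts G. D r \<le> degree G v}) \<le> \<epsilon> r * real (num_verts G)" using A by simp
      then have "real (card {v \<in> pverts G. D r \<le> degree G v}) * (1 + 2 * real r * real (c r))
          \<le> \<epsilon> r * real (num_verts G) * (1 + 2 * real r * real (c r))"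
        using denom[of r] by (intro mult_right_mono) simp_all
      also have "\<dots> = F_prop (real r) * real (num_verts G)"
        using denom[of r] by (simp add: \<epsilon>_def)
      finally have few: "real (card {v \<in> pverts G. D r \<le> degree G v}) * real (1 + 2 * r * c r)
          \<le> F_prop (real r) * real (num_verts G)" by simp
      have "sparse (parcs G) (2 * r) (D r + c r)"
      proof (rule sparse_if_dense_parts_large[OF graph few])
        fix S assume S: "is_subgraph S G" "real (num_verts S) \<le> F_prop (real r) * real (num_verts G)"
        then have "\<not> ereal (F_nabla (real r)) < top_nabla r S" using dense_large G by (meson not_less)
        then have "top_nabla r S \<le> ereal (F_nabla (real r))" by simp
        also have "\<dots> < ereal (real (c r))" using c by simp
        finally show "top_nabla r S < ereal (real (c r))" .
      qed
      then show ?thesis by (rule sparse_le) simp_all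
    next
      case False
      then have "card (pverts G) \<le> N r" unfolding N_def num_verts_def by linarith
      then have "sparse (parcs G) (2 * r) (N r)"
        using pair_graphD(1,2)[OF graph] by (intro sparse_few_vertices)
      then show ?thesis by (rule sparse_le) simp_all
    qed
    then show ?thesis by (rule sparse_le) simp_all
  qed
  then show "bounded_expansion \<C>"
    using assms by (intro bounded_expansion_if_uniformly_sparse[of \<C> "\<lambda>r. D r + c r + N r"])
qed

end
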